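(* Let $c=a+bi$ with $a,b\in\mathbb R$, $a<-1$ and $b\neq 0$. Then there exists $y_0$ such that for every real $y\geq y_0$, \[\{\xi\in\mathbb C\colon |\xi-1|<2y^a\}\subseteq\overline{\sigma_c(SF_{>y})}.\]
   Context: For $c\in\mathbb C$, $\sigma_c(n)=\sum_{d\mid n}d^c$ for positive integers $n$ (with $d^c=e^{c\log d}$, $\log d$ real). For real $y$, $SF_{>y}$ denotes the set of squarefree positive integers all of whose prime factors are greater than $y$ (this includes $1$). $\sigma_c(SF_{>y})=\{\sigma_c(n)\colon n\in SF_{>y}\}$, and the overline denotes topological closure in $\mathbb C$. *)

theory Defs
  imports
    "HOL-Analysis.Analysis"
    "HOL-Computational_Algebra.Squarefree"
begin

definition divisor_sigma :: "complex \<Rightarrow> nat \<Rightarrow> complex" where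
  "divisor_sigma c n = (\<Sum>d | d dvd n. of_nat d powr c)"

definition SF_gt :: "real \<Rightarrow> nat set" where
  "SF_gt y = {n. n > 0 \<and> squarefree n \<and> (\<forall>p\<in>prime_factors n. real p > y)}"

end

theory Submission
  imports Defs "HOL-Number_Theory.Prime_Powers"
begin

text \<open>
  Write \<open>p powr c = p powr a * p\<^bsup>ib\<^esup>\<close>. Since the radius \<open>2 y\<^sup>a\<close> has the size of a single term while there
  are many primes in \<open>(x, K x]\<close>, any \<open>\<xi>\<close> in the disc can be approached greedily: as long as the error
  \<open>e = \<xi> - \<sigma>(n)\<close> is large compared with \<open>x\<^sup>a\<close>, multiply \<open>n\<close> by an unused prime \<open>p\<close> for which
  \<open>\<sigma>(n) p\<^sup>c\<close> makes an acute angle, bounded away from the right angle, with \<open>e\<close>. Boundedly many primes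
  shrink the error from \<open>M x\<^sup>a\<close> to \<open>M (K x)\<^sup>a\<close>, and one iterates with \<open>K x\<close> in place of \<open>x\<close>.

  This needs many primes of \<open>(x, K x]\<close> in every direction \<open>p\<^bsup>ib\<^esup>\<close>. It suffices that, for \<open>t = b\<close>
  and \<open>t = 2b\<close>, the sums of \<open>ln p / p * p\<^bsup>it\<^esup>\<close> over \<open>p \<le> N\<close> are bounded, whereas those of
  \<open>ln p / p\<close> grow like \<open>ln N\<close>: then both \<open>s = Re (u p\<^bsup>ib\<^esup>)\<close> and \<open>s\<^sup>2 - 1/2\<close> average to nearly \<open>0\<close>
  over the primes of \<open>(x, K x]\<close>, so \<open>s\<close> is often bounded below by a positive constant. The bound is Mertens'
  argument for Dirichlet characters applied to \<open>n \<mapsto> n\<^bsup>it\<^esup>\<close>; it requires that the constant term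
  \<open>Z\<close> (that is, \<open>\<zeta>(1 - it)\<close>) of the sums of \<open>n\<^bsup>it\<^esup> / n\<close> is nonzero. If \<open>Z = 0\<close>, Moebius
  inversion shows that the sums of \<open>\<Lambda>(n) n\<^bsup>it\<^esup> / n\<close> equal \<open>- ln N + O(1)\<close>, which contradicts
  \<open>3 + 4 cos x + cos 2x \<ge> 0\<close>.
\<close>

section \<open>Oscillating harmonic sums\<close>

text \<open>This is x^{it} for x > 0. Writing it through \<open>cis\<close> makes its norm 1 without
  any side condition on x.\<close>

definition osc :: "real \<Rightarrow> real \<Rightarrow> complex" where
  "osc t x = cis (t * ln x)"

lemma norm_osc [simp]: "norm (osc t x) = 1"
  by (simp add: osc_def)

lemma osc_one [simp]: "osc t 1 = 1"
  by (simp add: osc_def)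

lemma osc_mult: "x > 0 \<Longrightarrow> y > 0 \<Longrightarrow> osc t (x * y) = osc t x * osc t y"
  by (simp add: osc_def ln_mult cis_mult ring_distribs)

lemma norm_cis_minus_one_le: "norm (cis x - 1) \<le> \<bar>x\<bar>"
  using Taylor_exp[of "\<i> * of_real x" 0] by (simp add: cis_conv_exp norm_mult)

lemma norm_cis_minus_linear_le: "norm (cis x - 1 - \<i> * of_real x) \<le> x\<^sup>2"
  using Taylor_exp[of "\<i> * of_real x" 1]
  by (simp add: cis_conv_exp norm_mult algebra_simps power2_eq_square)

lemma norm_osc_diff_le: "norm (osc t x - osc t y) \<le> \<bar>t\<bar> * \<bar>ln x - ln y\<bar>"
proof -
  have "osc t x - osc t y = cis (t * ln y) * (cis (t * (ln x - ln y)) - 1)"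
    by (simp add: osc_def cis_mult ring_distribs right_diff_distrib)
  then have "norm (osc t x - osc t y) = norm (cis (t * (ln x - ln y)) - 1)"
    by (simp add: norm_mult)
  also have "\<dots> \<le> \<bar>t * (ln x - ln y)\<bar>"
    by (rule norm_cis_minus_one_le)
  finally show ?thesis by (simp add: abs_mult)
qed

section \<open>Sequences with increments O(1/n^2), by telescoping\<close>

lemma inverse_square_bounds:
  assumes "x > (0::real)"
  shows "1 / x - 1 / (x + 1) \<le> 1 / x\<^sup>2" "x \<ge> 1 \<Longrightarrow> 1 / x\<^sup>2 \<le> 2 / x - 2 / (x + 1)"
  using assms by (auto simp: divide_simps power2_eq_square)

lemma ln_Suc_diff_bounds:
  assumes "n > 0"
  shows "ln (real (Suc n)) - ln (real n) \<le> 1 / real n"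
    and "1 / real (Suc n) \<le> ln (real (Suc n)) - ln (real n)"
    and "\<bar>1 / real (Suc n) - (ln (real (Suc n)) - ln (real n))\<bar> \<le> 1 / (real n)\<^sup>2"
proof -
  have n: "real n > 0" using assms by simp
  show 1: "ln (real (Suc n)) - ln (real n) \<le> 1 / real n"
    using ln_diff_le[of "real (Suc n)" "real n"] n by (simp add: field_simps)
  have "ln (real n) - ln (real (Suc n)) \<le> (real n - real (Suc n)) / real (Suc n)"
    using n by (intro ln_diff_le) auto
  then show 2: "1 / real (Suc n) \<le> ln (real (Suc n)) - ln (real n)"
    by simp
  have "1 / real n - 1 / real (Suc n) \<le> 1 / (real n)\<^sup>2"
    using inverse_square_bounds(1)[OF n] by (simp add: add.commute)
  with 1 2 show "\<bar>1 / real (Suc n) - (ln (real (Suc n)) - ln (real n))\<bar> \<le> 1 / (real n)\<^sup>2"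
    by linarith
qed

text \<open>Tails are bounded by telescoping 1/k^2 \<le> 2/k - 2/(k+1). The limit l supplies the
  constant terms of the asymptotics below (Euler's constant, a value of zeta) without any need to
  compute them.\<close>

lemma convergence_rate_of_quadratic_increments:
  fixes f :: "nat \<Rightarrow> 'a :: banach"
  assumes incr: "\<And>n. n > 0 \<Longrightarrow> norm (f (Suc n) - f n) \<le> C / (real n)\<^sup>2"
  shows "\<exists>l. \<forall>n>0. norm (f n - l) \<le> 2 * C / real n"
proof -
  have C: "C \<ge> 0"
    using order_trans[OF norm_ge_zero incr[of 1]] by simp
  \<comment> \<open>Keeping the negative term \<open>- 2 * C / real m\<close> makes the induction on
    m telescope.\<close>
  have tail: "norm (f m - f n) \<le> 2 * C / real n - 2 * C / real m" if "n > 0" "n \<le> m" for m n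
    using that(2,1)
  proof (induction m rule: dec_induct)
    case (step m)
    then have m: "real m > 0" by simp
    have "1 / (real m)\<^sup>2 \<le> 2 / real m - 2 / real (Suc m)"
      using inverse_square_bounds(2)[OF m] m by (simp add: add.commute)
    then have "C * (1 / (real m)\<^sup>2) \<le> C * (2 / real m - 2 / real (Suc m))"
      using C by (rule mult_left_mono)
    with incr[of m] m have 1: "norm (f (Suc m) - f m) \<le> 2 * C / real m - 2 * C / real (Suc m)"
      by (simp add: algebra_simps)
    have "norm (f (Suc m) - f n) \<le> norm (f (Suc m) - f m) + norm (f m - f n)"
      using norm_triangle_ineq[of "f (Suc m) - f m" "f m - f n"] by simp
    with 1 step show ?case by simp
  qed auto
  have "Cauchy f"
  proof (rule metric_CauchyI)
    fix e :: real assume e: "e > 0"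
    obtain M :: nat where M: "2 * C / e < real M" using reals_Archimedean2 by blast
    moreover have "2 * C / e \<ge> 0" using C e by simp
    ultimately have "real M > 0" by linarith
    then have M': "M > 0" "2 * C / real M < e" using M e by (auto simp: field_simps)
    show "\<exists>M. \<forall>m\<ge>M. \<forall>n\<ge>M. dist (f m) (f n) < e"
    proof (rule exI[of _ M], intro allI impI)
      have *: "dist (f m) (f n) < e" if "M \<le> m" "m \<le> n" for m n
      proof -
        have "dist (f m) (f n) \<le> 2 * C / real m - 2 * C / real n"
          using tail[of m n] that M' by (simp add: norm_minus_commute dist_norm)
        also have "\<dots> \<le> 2 * C / real m" using C by simp
        also have "\<dots> \<le> 2 * C / real M"
          using C that M' by (intro divide_left_mono) auto
        finally show ?thesis using M' by simp
      qed
      fix m n assume "M \<le> m" "M \<le> n"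
      with *[of m n] *[of n m] show "dist (f m) (f n) < e"
        by (cases "m \<le> n") (auto simp: dist_commute)
    qed
  qed
  then obtain l where l: "f \<longlonglongrightarrow> l"
    using Cauchy_convergent_iff convergent_def by blast
  have "norm (f n - l) \<le> 2 * C / real n" if "n > 0" for n
  proof (rule LIMSEQ_le_const2)
    show "(\<lambda>m. norm (f n - f m)) \<longlonglongrightarrow> norm (f n - l)"
      by (intro tendsto_intros l)
    show "\<exists>N. \<forall>m\<ge>N. norm (f n - f m) \<le> 2 * C / real n"
    proof (rule exI[of _ n], intro allI impI)
      fix m assume "m \<ge> n"
      then show "norm (f n - f m) \<le> 2 * C / real n"
        using tail[OF that, of m] divide_nonneg_nonneg[of "2 * C" "real m"] C
        unfolding norm_minus_commute[of "f n"] by linarith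
    qed
  qed
  then show ?thesis by blast
qed

lemma bounded_of_quadratic_increments:
  fixes f :: "nat \<Rightarrow> 'a :: banach"
  assumes "\<And>n. n > 0 \<Longrightarrow> norm (f (Suc n) - f n) \<le> C / (real n)\<^sup>2"
  shows "\<exists>B. \<forall>n>0. norm (f n) \<le> B"
proof -
  obtain l where l: "\<forall>n>0. norm (f n - l) \<le> 2 * C / real n"
    using convergence_rate_of_quadratic_increments[OF assms] by blast
  have C: "C \<ge> 0"
    using order_trans[OF norm_ge_zero assms[of 1]] by simp
  have "norm (f n) \<le> norm l + 2 * C" if "n > 0" for n
  proof -
    have "norm (f n) \<le> norm l + norm (f n - l)" by (metis add.commute norm_triangle_sub)
    moreover have "2 * C / real n \<le> 2 * C / 1" using C that by (intro divide_left_mono) auto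
    moreover have "norm (f n - l) \<le> 2 * C / real n" using l that by blast
    ultimately show ?thesis by linarith
  qed
  then show ?thesis by blast
qed

section \<open>Asymptotics of the sums of n^{it}/n and of 1/n\<close>

definition osc_sum :: "real \<Rightarrow> nat \<Rightarrow> complex" where
  "osc_sum t N = (\<Sum>n=1..N. osc t (real n) / of_nat n)"

lemma osc_sum_Suc: "osc_sum t (Suc n) = osc_sum t n + osc t (Suc n) / of_nat (Suc n)"
  by (simp add: osc_sum_def)

text \<open>The derivative of x^{it}/(it) is x^{it}/x, so its increment over [n, n+1] agrees with
  the term at n+1 up to second order.\<close>

lemma osc_increment:
  assumes "n > 0" and t: "t \<noteq> 0"
  shows "norm (osc t (Suc n) / of_nat (Suc n) - (osc t (Suc n) - osc t n) / (\<i> * t))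
           \<le> (1 + \<bar>t\<bar>) / (real n)\<^sup>2"
proof -
  define h where "h = ln (real (Suc n)) - ln (real n)"
  have h: "0 \<le> h" "h \<le> 1 / n" "\<bar>1 / real (Suc n) - h\<bar> \<le> 1 / (real n)\<^sup>2"
    using ln_Suc_diff_bounds[OF assms(1)] unfolding h_def
    by (smt (verit) divide_nonneg_nonneg of_nat_0_le_iff)+
  \<comment> \<open>\<open>w\<close> is the second-order Taylor remainder of
    \<open>cis (- t * h)\<close>, the quotient of \<open>osc t n\<close> by
    \<open>osc t (Suc n)\<close>. The linear part contributes exactly h, which differs from 1/(n+1)
    by at most 1/n^2.\<close>
  define w where "w = cis (- t * h) - 1 - \<i> * of_real (- t * h)"
  have n: "osc t n = osc t (Suc n) * cis (- t * h)"
    by (simp add: osc_def h_def cis_mult algebra_simps)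
  have "osc t (Suc n) / of_nat (Suc n) - (osc t (Suc n) - osc t n) / (\<i> * t) =
        osc t (Suc n) * (of_real (1 / real (Suc n) - h) + w / (\<i> * t))"
  proof -
    have "w / (\<i> * t) = (cis (- t * h) - 1) / (\<i> * t) + h"
      using t by (simp add: w_def diff_divide_distrib add_divide_distrib)
    moreover have "q / s - (q - q * e) / j = q * ((1 / s - of_real h) + ((e - 1) / j + of_real h))"
      for q e j s :: complex
      by (simp add: algebra_simps diff_divide_distrib)
    ultimately show ?thesis
      unfolding n by (simp only: of_real_diff of_real_divide of_real_1 of_real_of_nat_eq)
  qed
  then have "norm (osc t (Suc n) / of_nat (Suc n) - (osc t (Suc n) - osc t n) / (\<i> * t)) =
        norm (complex_of_real (1 / real (Suc n) - h) + w / (\<i> * t))"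
    by (simp only: norm_mult norm_osc mult_1)
  also have "\<dots> \<le> \<bar>1 / real (Suc n) - h\<bar> + norm w / \<bar>t\<bar>"
    by (rule order_trans[OF norm_triangle_ineq]) (simp add: norm_divide norm_mult del: of_real_diff of_real_divide)
  also have "norm w / \<bar>t\<bar> \<le> (- t * h)\<^sup>2 / \<bar>t\<bar>"
    unfolding w_def by (intro divide_right_mono norm_cis_minus_linear_le) auto
  also have "\<dots> = \<bar>t\<bar> * h\<^sup>2"
    using t by (simp add: power2_eq_square field_simps abs_if)
  also have "\<dots> \<le> \<bar>t\<bar> * (1 / n)\<^sup>2"
    using h by (intro mult_left_mono power_mono) auto
  also have "\<bar>1 / real (Suc n) - h\<bar> + \<bar>t\<bar> * (1 / n)\<^sup>2 \<le> 1 / (real n)\<^sup>2 + \<bar>t\<bar> * (1 / n)\<^sup>2"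
    using h by simp
  also have "\<dots> = (1 + \<bar>t\<bar>) / (real n)\<^sup>2"
    by (simp add: add_divide_distrib power_divide)
  finally show ?thesis by simp
qed

text \<open>Replacing a real x by its integer part n costs O(1/x); the factor 2 comes from x < n + 1
  \<le> 2n.\<close>

lemma floor_real_bounds:
  assumes "x \<ge> (1::real)"
  shows "nat \<lfloor>x\<rfloor> > 0" "real (nat \<lfloor>x\<rfloor>) \<le> x" "1 / real (nat \<lfloor>x\<rfloor>) \<le> 2 / x"
    "0 \<le> ln x - ln (real (nat \<lfloor>x\<rfloor>))" "ln x - ln (real (nat \<lfloor>x\<rfloor>)) \<le> 2 / x"
proof -
  define n where "n = nat \<lfloor>x\<rfloor>"
  have 1: "n \<ge> 1" unfolding n_def using assms by linarith
  then have one: "real n \<ge> 1" by simp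
  have 2: "real n \<le> x" "x < real n + 1" unfolding n_def using assms by linarith+
  have "x \<le> 2 * real n" using one 2 by linarith
  then have 3: "1 / real n \<le> 2 / x" using one assms by (simp add: divide_simps)
  have "ln x - ln (real n) \<le> (x - real n) / real n"
    using one assms by (intro ln_diff_le) auto
  also have "\<dots> \<le> 1 / real n"
    using one 2 by (intro divide_right_mono) auto
  finally have 4: "ln x - ln (real n) \<le> 1 / real n" .
  show "nat \<lfloor>x\<rfloor> > 0" "real (nat \<lfloor>x\<rfloor>) \<le> x" "1 / real (nat \<lfloor>x\<rfloor>) \<le> 2 / x"
    "0 \<le> ln x - ln (real (nat \<lfloor>x\<rfloor>))" "ln x - ln (real (nat \<lfloor>x\<rfloor>)) \<le> 2 / x"
    unfolding n_def[symmetric] using 1 one 2 3 4 by auto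
qed

text \<open>After subtraction of the antiderivative x^{it}/(it) the increments are quadratically
  small, so a constant Z remains. Real x is allowed because the later arguments are x = N/d, with
  integer part \<open>N div d\<close>.\<close>

lemma osc_sum_asymptotics:
  assumes t: "t \<noteq> 0"
  shows "\<exists>Z C. \<forall>x\<ge>1. norm (osc_sum t (nat \<lfloor>x\<rfloor>) - Z - osc t x / (\<i> * t)) \<le> C / x"
proof -
  define f where "f = (\<lambda>n::nat. osc_sum t n - osc t n / (\<i> * t))"
  have "norm (f (Suc n) - f n) \<le> (1 + \<bar>t\<bar>) / (real n)\<^sup>2" if "n > 0" for n
  proof -
    have "f (Suc n) - f n =
        osc t (Suc n) / of_nat (Suc n) - (osc t (Suc n) - osc t n) / (\<i> * t)"
      by (simp add: f_def osc_sum_Suc diff_divide_distrib del: of_nat_Suc)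
    then show ?thesis using osc_increment[OF that t] by (simp only:)
  qed
  from convergence_rate_of_quadratic_increments[OF this] obtain Z
    where Z: "\<And>n. n > 0 \<Longrightarrow> norm (f n - Z) \<le> 2 * (1 + \<bar>t\<bar>) / real n" by blast
  have "norm (osc_sum t (nat \<lfloor>x\<rfloor>) - Z - osc t x / (\<i> * t)) \<le> (4 * (1 + \<bar>t\<bar>) + 2) / x"
    if x: "x \<ge> 1" for x
  proof -
    define n where "n = nat \<lfloor>x\<rfloor>"
    note n = floor_real_bounds[OF x, folded n_def]
    have "osc_sum t n - Z - osc t x / (\<i> * t) = (f n - Z) + (osc t n - osc t x) / (\<i> * t)"
      by (simp add: f_def diff_divide_distrib)
    then have "norm (osc_sum t n - Z - osc t x / (\<i> * t)) \<le>
        norm (f n - Z) + norm ((osc t n - osc t x) / (\<i> * t))"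
      by (simp only: norm_triangle_ineq)
    also have "norm ((osc t n - osc t x) / (\<i> * t)) = norm (osc t n - osc t x) / \<bar>t\<bar>"
      by (simp add: norm_divide norm_mult)
    also have "norm (osc t n - osc t x) / \<bar>t\<bar> \<le> \<bar>ln (real n) - ln x\<bar>"
      using norm_osc_diff_le[of t n x] t by (simp add: field_simps)
    also have "\<dots> \<le> 2 / x" using n by linarith
    also have "norm (f n - Z) \<le> 2 * (1 + \<bar>t\<bar>) * (1 / real n)"
      using Z[OF n(1)] by simp
    also have "\<dots> \<le> 2 * (1 + \<bar>t\<bar>) * (2 / x)"
      using n by (intro mult_left_mono) auto
    finally show ?thesis by (simp add: n_def add_divide_distrib)
  qed
  then show ?thesis by blast
qed

text \<open>The analogue for t = 0, where the antiderivative of 1/x is ln x; \<gamma> is Euler's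
  constant.\<close>

lemma harm_asymptotics:
  "\<exists>\<gamma> C. \<forall>x\<ge>1. \<bar>harm (nat \<lfloor>x\<rfloor>) - ln x - \<gamma>\<bar> \<le> C / (x::real)"
proof -
  define f where "f = (\<lambda>n::nat. harm n - ln (real n))"
  have "norm (f (Suc n) - f n) \<le> 1 / (real n)\<^sup>2" if "n > 0" for n
  proof -
    have "f (Suc n) - f n = 1 / real (Suc n) - (ln (real (Suc n)) - ln (real n))"
      by (simp add: f_def harm_Suc inverse_eq_divide del: of_nat_Suc)
    then show ?thesis using ln_Suc_diff_bounds(3)[OF that] by (simp only: real_norm_def)
  qed
  from convergence_rate_of_quadratic_increments[OF this] obtain g
    where g: "\<And>n. n > 0 \<Longrightarrow> norm (f n - g) \<le> 2 * 1 / real n" by blast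
  have "\<bar>harm (nat \<lfloor>x\<rfloor>) - ln x - g\<bar> \<le> 6 / x" if x: "x \<ge> 1" for x
  proof -
    note n = floor_real_bounds[OF x]
    have "\<bar>harm (nat \<lfloor>x\<rfloor>) - ln (real (nat \<lfloor>x\<rfloor>)) - g\<bar> \<le> 2 * (1 / real (nat \<lfloor>x\<rfloor>))"
      using g[OF n(1)] unfolding f_def by simp
    also have "\<dots> \<le> 2 * (2 / x)" using n by simp
    finally have "\<bar>harm (nat \<lfloor>x\<rfloor>) - ln (real (nat \<lfloor>x\<rfloor>)) - g\<bar> \<le> 4 / x" by simp
    moreover have "4 / x + 2 / x = 6 / x" by simp
    ultimately show ?thesis using n(4,5) by linarith
  qed
  then show ?thesis by blast
qed

section \<open>Chebyshev and Mertens estimates\<close>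

text \<open>Pairs (n, d) with d dividing n \<le> N correspond to pairs (d, m) with d m \<le> N
  through n = d m. Every Dirichlet convolution below is summed this way.\<close>

lemma sum_divisors_swap:
  fixes f :: "nat \<Rightarrow> nat \<Rightarrow> 'a :: comm_monoid_add"
  shows "(\<Sum>n=1..N. \<Sum>d | d dvd n. f d (n div d)) = (\<Sum>d=1..N. \<Sum>m=1..N div d. f d m)"
proof -
  have fin: "finite {d. d dvd n}" if "n \<in> {1..N}" for n :: nat
    using that by (intro finite_divisors_nat) auto
  have "(\<Sum>n=1..N. \<Sum>d | d dvd n. f d (n div d)) =
        (\<Sum>(n, d) \<in> (SIGMA n:{1..N}. {d. d dvd n}). f d (n div d))"
    using fin by (subst sum.Sigma) auto
  also have "\<dots> = (\<Sum>(d, m) \<in> (SIGMA d:{1..N}. {1..N div d}). f d m)"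
  proof (rule sum.reindex_bij_witness[of _ "\<lambda>(d, m). (d * m, d)" "\<lambda>(n, d). (d, n div d)"])
    fix x assume "x \<in> (SIGMA n:{1..N}. {d. d dvd n})"
    then obtain d m where x: "x = (d * m, d)" "d * m > 0" "d * m \<le> N"
      by (auto elim!: dvdE)
    then have d: "d > 0" "m > 0" by auto
    then show "(case x of (n, d) \<Rightarrow> (d, n div d)) \<in> (SIGMA d:{1..N}. {1..N div d})"
      using x by (auto simp: less_eq_div_iff_mult_less_eq mult.commute Suc_le_eq intro: order_trans[of _ "d * m"])
    show "(case case x of (n, d) \<Rightarrow> (d, n div d) of (d, m) \<Rightarrow> (d * m, d)) = x"
      "(case case x of (n, d) \<Rightarrow> (d, n div d) of (d, m) \<Rightarrow> f d m) = (case x of (n, d) \<Rightarrow> f d (n div d))"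
      using x d by auto
  next
    fix x assume "x \<in> (SIGMA d:{1..N}. {1..N div d})"
    then obtain d m where x: "x = (d, m)" "d > 0" "m > 0" "m \<le> N div d" by auto
    then show "(case x of (d, m) \<Rightarrow> (d * m, d)) \<in> (SIGMA n:{1..N}. {d. d dvd n})"
      by (auto simp: less_eq_div_iff_mult_less_eq mult.commute Suc_le_eq)
    show "(case case x of (d, m) \<Rightarrow> (d * m, d) of (n, d) \<Rightarrow> (d, n div d)) = x"
      using x by auto
  qed
  also have "\<dots> = (\<Sum>d=1..N. \<Sum>m=1..N div d. f d m)"
    by (subst sum.Sigma) auto
  finally show ?thesis .
qed

definition chebyshev_psi :: "nat \<Rightarrow> real" where
  "chebyshev_psi N = (\<Sum>n=1..N. mangoldt n)"

text \<open>Sum ln n = sum of Lambda(d) over d dividing n, and count the multiples of each d up to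
  N.\<close>

lemma ln_fact_eq_sum_mangoldt:
  "ln (fact N :: real) = (\<Sum>d=1..N. mangoldt d * real (N div d))"
proof -
  have "ln (fact N :: real) = (\<Sum>n=1..N. ln (real n))"
    by (induction N) (auto simp: ln_mult)
  also have "\<dots> = (\<Sum>n=1..N. \<Sum>d | d dvd n. mangoldt d)"
    by (intro sum.cong) (auto simp: mangoldt_sum)
  also have "\<dots> = (\<Sum>d=1..N. \<Sum>m=1..N div d. mangoldt d)"
    by (rule sum_divisors_swap)
  finally show ?thesis by (simp add: mult.commute)
qed

text \<open>In ln (2N choose N) the coefficient of Lambda(d) is
  \<open>2 * N div d - 2 * (N div d)\<close>. It is nonnegative, and at least 1 for N < d \<le> 2N,
  while the binomial coefficient is at most 4^N.\<close>

lemma chebyshev_psi_double: "chebyshev_psi (2 * N) - chebyshev_psi N \<le> 2 * ln 2 * real N"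
proof -
  have coeff: "2 * (N div d) \<le> 2 * N div d" for d
    by (metis div_mult2_eq mult.commute mult.left_commute div_times_less_eq_dividend
        less_eq_div_iff_mult_less_eq nat_mult_le_cancel1 div_by_0 le0 mult_0_right not_gr_zero mult_le_mono2)
  have "chebyshev_psi (2 * N) - chebyshev_psi N = (\<Sum>d\<in>{1..2*N} - {1..N}. mangoldt d)"
    unfolding chebyshev_psi_def by (subst sum_diff) auto
  also have "\<dots> \<le> (\<Sum>d\<in>{1..2*N} - {1..N}. mangoldt d * (real (2 * N div d) - 2 * real (N div d)))"
  proof (rule sum_mono)
    fix d assume d: "d \<in> {1..2*N} - {1..N}"
    then have "N div d = 0" by auto
    moreover have "2 * N div d \<ge> 1"
      using d by (auto simp: Suc_le_eq div_greater_zero_iff)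
    ultimately show "mangoldt d \<le> mangoldt d * (real (2 * N div d) - 2 * real (N div d))"
      using mult_left_mono[of 1 "real (2 * N div d)" "mangoldt d :: real"] mangoldt_nonneg[of d] by simp
  qed
  also have "\<dots> \<le> (\<Sum>d=1..2*N. mangoldt d * (real (2 * N div d) - 2 * real (N div d)))"
  proof (rule sum_mono2)
    fix d
    have "real (2 * (N div d)) \<le> real (2 * N div d)" using coeff of_nat_le_iff by blast
    then show "0 \<le> mangoldt d * (real (2 * N div d) - 2 * real (N div d))"
      by (intro mult_nonneg_nonneg mangoldt_nonneg) auto
  qed auto
  also have "\<dots> = ln (fact (2 * N)) - 2 * (\<Sum>d=1..2*N. mangoldt d * real (N div d))"
    by (simp add: ln_fact_eq_sum_mangoldt sum_subtractf right_diff_distrib sum_distrib_left mult_ac)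
  also have "(\<Sum>d=1..2*N. mangoldt d * real (N div d)) = (\<Sum>d=1..N. mangoldt d * real (N div d))"
    by (intro sum.mono_neutral_right) auto
  also have "ln (fact (2 * N)) - 2 * \<dots> = ln (fact (2 * N)) - 2 * ln (fact N :: real)"
    by (simp add: ln_fact_eq_sum_mangoldt)
  also have "\<dots> \<le> 2 * ln 2 * real N"
  proof -
    have "(2 * N) choose N \<le> 2 ^ (2 * N)" by (rule binomial_le_pow2)
    moreover have "fact N * fact N * ((2 * N) choose N) = (fact (2 * N) :: nat)"
      using binomial_fact_lemma[of N "2 * N"] by simp
    ultimately have "(fact (2 * N) :: nat) \<le> fact N * fact N * 2 ^ (2 * N)"
      by (metis mult_le_mono2)
    then have "(fact (2 * N) :: real) \<le> fact N * fact N * 2 ^ (2 * N)"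
      using of_nat_le_iff[where ?'a = real, THEN iffD2, of "fact (2 * N)"] by fastforce
    then have "ln (fact (2 * N) :: real) \<le> ln (fact N * fact N * 2 ^ (2 * N))"
      by (subst ln_le_cancel_iff) auto
    also have "\<dots> = 2 * ln (fact N) + 2 * ln 2 * real N"
      by (simp add: ln_mult ln_realpow)
    finally show ?thesis by simp
  qed
  finally show ?thesis .
qed

text \<open>Induction by halving. With N = 2M or 2M + 1 the doubling bound gives 4M + 2M = 6M, and
  the slack 2M up to 8M absorbs the extra term ln N \<le> N - 1 of the odd case.\<close>

lemma chebyshev_psi_le: "chebyshev_psi N \<le> 4 * real N"
proof (induction N rule: less_induct)
  case (less N)
  define M where "M = N div 2"
  show ?case
  proof (cases "N = 0")
    case False
    then have "M < N" by (simp add: M_def)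
    have ln2: "ln 2 \<le> (1::real)" using ln_le_minus_one[of "2::real"] by simp
    have M: "chebyshev_psi (2 * M) \<le> 6 * real M"
      using chebyshev_psi_double[of M] less[OF \<open>M < N\<close>] mult_right_mono[OF ln2, of "2 * real M"] by simp
    show ?thesis
    proof (cases "even N")
      case True
      then have "N = 2 * M" by (simp add: M_def)
      with M show ?thesis by simp
    next
      case False
      then have N: "N = Suc (2 * M)" by (simp add: M_def)
      have "mangoldt N \<le> ln (real N)" using N by (intro mangoldt_le) auto
      also have "\<dots> \<le> 2 * real M" using ln_le_minus_one[of "real N"] N by simp
      finally show ?thesis using M N by (simp add: chebyshev_psi_def)
    qed
  qed (simp add: chebyshev_psi_def)
qed

text \<open>A weak Stirling formula: N^N / N! is a single term of the exponential series for
  e^N.\<close>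

lemma ln_fact_bounds:
  assumes "N > 0"
  shows "real N * ln (real N) - real N \<le> ln (fact N)" "ln (fact N) \<le> real N * ln (real N)"
proof -
  have "real N ^ N / fact N = (\<Sum>k\<in>{N}. inverse (fact k) * real N ^ k)"
    by (simp add: divide_inverse mult.commute)
  also have "\<dots> \<le> (\<Sum>k. inverse (fact k) * real N ^ k)"
    by (rule sum_le_suminf[OF summable_exp]) auto
  also have "\<dots> = exp (real N)" by (simp add: exp_def)
  finally have "ln (real N ^ N / fact N) \<le> ln (exp (real N))"
    using assms by (subst ln_le_cancel_iff) auto
  then show "real N * ln (real N) - real N \<le> ln (fact N)"
    using assms by (simp add: ln_div ln_realpow)
  have "(fact N :: real) \<le> real N ^ N" using fact_le_power[of N] by simp
  then have "ln (fact N) \<le> ln (real N ^ N)"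
    using assms by (subst ln_le_cancel_iff) auto
  then show "ln (fact N) \<le> real N * ln (real N)"
    using assms by (simp add: ln_realpow)
qed

text \<open>Mertens' argument: in the formula for ln N!, which is N ln N + O(N), replace
  \<open>N div d\<close> by N/d. The rounding costs at most psi(N) \<le> 4N; then divide by
  N.\<close>

lemma sum_mangoldt_over_n:
  assumes "N > 0"
  shows "\<bar>(\<Sum>d=1..N. mangoldt d / real d) - ln (real N)\<bar> \<le> 4"
proof -
  define S where "S = (\<Sum>d=1..N. mangoldt d / real d)"
  have div: "real N / real d - 1 \<le> real (N div d)" "real (N div d) \<le> real N / real d" for d
    using floor_divide_of_nat_eq[where ?'a = real, of N d] by linarith+
  have "ln (fact N) \<le> (\<Sum>d=1..N. mangoldt d * (real N / real d))"
    unfolding ln_fact_eq_sum_mangoldt by (intro sum_mono mult_left_mono div mangoldt_nonneg)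
  also have "\<dots> = real N * S" by (simp add: S_def sum_distrib_left mult_ac)
  finally have "real N * (ln (real N) - S) \<le> real N * 1"
    using ln_fact_bounds[OF assms] by (simp add: algebra_simps)
  then have 1: "ln (real N) - S \<le> 1" using assms mult_le_cancel_left_pos[of "real N"] by simp
  have "real N * S - chebyshev_psi N = (\<Sum>d=1..N. mangoldt d * (real N / real d - 1))"
    by (simp add: S_def sum_distrib_left mult_ac chebyshev_psi_def right_diff_distrib sum_subtractf)
  also have "\<dots> \<le> ln (fact N)"
    unfolding ln_fact_eq_sum_mangoldt by (intro sum_mono mult_left_mono div mangoldt_nonneg)
  finally have "real N * (S - ln (real N)) \<le> real N * 4"
    using ln_fact_bounds[OF assms] chebyshev_psi_le[of N] by (simp add: algebra_simps)
  then have "S - ln (real N) \<le> 4" using assms mult_le_cancel_left_pos[of "real N"] by simp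
  with 1 show ?thesis unfolding S_def by linarith
qed

section \<open>Mean values of the Moebius function\<close>

definition moebius_mu :: "nat \<Rightarrow> real" where
  "moebius_mu n = (if squarefree n then (-1) ^ card (prime_factors n) else 0)"

lemma abs_moebius_le: "\<bar>moebius_mu n\<bar> \<le> 1"
  by (simp add: moebius_mu_def)

lemma moebius_prime_mult:
  assumes "prime p" "\<not> p dvd d" "d > 0"
  shows "moebius_mu (p * d) = - moebius_mu d"
proof -
  have cop: "coprime p d" using assms by (simp add: prime_imp_coprime)
  have "squarefree (p * d) \<longleftrightarrow> squarefree d"
    using squarefree_mult_coprime[OF cop] squarefree_multD(2)[of p d] squarefree_prime[OF assms(1)] by blast
  moreover have "prime_factors (p * d) = insert p (prime_factors d)"
    using assms by (subst prime_factors_product) (auto simp: prime_factorization_prime)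
  moreover have "p \<notin> prime_factors d" using assms by auto
  ultimately show ?thesis by (auto simp: moebius_mu_def)
qed

text \<open>Fix a prime p dividing n. The squarefree divisors split into pairs d, p d with p not
  dividing d, and the two members of a pair cancel.\<close>

lemma sum_moebius_divisors:
  assumes "n > 0"
  shows "(\<Sum>d | d dvd n. moebius_mu d) = (if n = 1 then 1 else 0)"
proof (cases "n = 1")
  case True
  then show ?thesis by (simp add: moebius_mu_def)
next
  case False
  then obtain p where p: "prime p" "p dvd n" using prime_factor_nat by blast
  define A where "A = {d. d dvd n \<and> squarefree d \<and> \<not> p dvd d}"
  have fin: "finite {d. d dvd n}" using assms by (intro finite_divisors_nat)
  have finA: "finite A" unfolding A_def by (rule finite_subset[OF _ fin]) auto
  have "d > 0" if "d \<in> A" for d using that assms by (auto simp: A_def intro!: Nat.gr0I)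
  note pos = this
  have cop: "coprime p d" if "d \<in> A" for d
    using that p by (auto simp: A_def prime_imp_coprime)
  have eq: "{d. d dvd n \<and> squarefree d} = A \<union> (*) p ` A"
  proof (intro equalityI subsetI)
    fix d assume d: "d \<in> {d. d dvd n \<and> squarefree d}"
    show "d \<in> A \<union> (*) p ` A"
    proof (cases "p dvd d")
      case True
      then obtain e where e: "d = p * e" by blast
      have "\<not> p dvd e"
      proof
        assume "p dvd e"
        then have "p\<^sup>2 dvd d" using e by (auto simp: power2_eq_square)
        then have "is_unit p" using d by (auto simp: squarefree_def)
        with p show False by simp
      qed
      then have "e \<in> A"
        using d e squarefree_multD(2)[of p e] by (auto simp: A_def dest: dvd_mult_right)
      with e show ?thesis by blast
    qed (use d in \<open>auto simp: A_def\<close>)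
  next
    fix d assume "d \<in> A \<union> (*) p ` A"
    then show "d \<in> {d. d dvd n \<and> squarefree d}"
      using p cop squarefree_mult_coprime squarefree_prime[OF p(1)]
      by (auto simp: A_def intro!: divides_mult)
  qed
  have "(\<Sum>d | d dvd n. moebius_mu d) = (\<Sum>d | d dvd n \<and> squarefree d. moebius_mu d)"
    using fin by (intro sum.mono_neutral_right) (auto simp: moebius_mu_def)
  also have "\<dots> = (\<Sum>d\<in>A. moebius_mu d) + (\<Sum>d\<in>(*) p ` A. moebius_mu d)"
    unfolding eq using finA by (intro sum.union_disjoint) (auto simp: A_def)
  also have "(\<Sum>d\<in>(*) p ` A. moebius_mu d) = (\<Sum>d\<in>A. moebius_mu (p * d))"
    using p by (subst sum.reindex) (auto simp: inj_on_def)
  also have "\<dots> = (\<Sum>d\<in>A. - moebius_mu d)"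
    using p pos by (intro sum.cong moebius_prime_mult) (auto simp: A_def)
  finally show ?thesis using False by (simp add: sum_negf)
qed

text \<open>Moebius inversion of the divisor sum of Lambda gives Lambda(n) as the sum of mu(d)
  ln(n/d); then ln(n/d) is split as ln n - ln d.\<close>

lemma sum_moebius_ln_divisors:
  assumes n: "n > 0"
  shows "(\<Sum>d | d dvd n. moebius_mu d * ln (real d)) = - mangoldt n"
proof -
  let ?D = "{d. d dvd n}"
  have fin: "finite ?D" using n by (intro finite_divisors_nat)
  have divs: "{e \<in> ?D. d * e dvd n} = {e. e dvd n div d}" if "d dvd n" for d
    using that n by (auto simp: dvd_div_iff_mult mult.commute dest: dvd_mult_left)
  have "(\<Sum>d\<in>?D. moebius_mu d * ln (real (n div d))) = (\<Sum>d\<in>?D. \<Sum>e\<in>{e \<in> ?D. d * e dvd n}. moebius_mu d * mangoldt e)"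
  proof (intro sum.cong refl)
    fix d assume d: "d \<in> ?D"
    then have "n div d > 0" using n by (auto simp: div_greater_zero_iff dvd_imp_le intro!: Nat.gr0I)
    then show "moebius_mu d * ln (real (n div d)) = (\<Sum>e\<in>{e \<in> ?D. d * e dvd n}. moebius_mu d * mangoldt e)"
      using d divs mangoldt_sum[of "n div d", where ?'a = real]
      by (simp add: sum_distrib_left[symmetric])
  qed
  also have "\<dots> = (\<Sum>e\<in>?D. \<Sum>d\<in>{d \<in> ?D. d * e dvd n}. moebius_mu d * mangoldt e)"
    by (rule sum.swap_restrict[OF fin fin])
  also have "\<dots> = (\<Sum>e\<in>?D. mangoldt e * (if e = n then 1 else 0))"
  proof (intro sum.cong refl)
    fix e assume e: "e \<in> ?D"
    then have pos: "n div e > 0" using n by (auto simp: div_greater_zero_iff dvd_imp_le intro!: Nat.gr0I)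
    have "(\<Sum>d\<in>{d \<in> ?D. d * e dvd n}. moebius_mu d * mangoldt e) = mangoldt e * (\<Sum>d | d dvd n div e. moebius_mu d)"
      using divs[of e] e by (simp add: sum_distrib_left mult.commute)
    moreover have "n div e = 1 \<longleftrightarrow> e = n"
      using e n by (auto elim!: dvdE)
    ultimately show "(\<Sum>d\<in>{d \<in> ?D. d * e dvd n}. moebius_mu d * mangoldt e) = mangoldt e * (if e = n then 1 else 0)"
      using sum_moebius_divisors[OF pos] by simp
  qed
  also have "\<dots> = mangoldt n"
    using fin by (simp add: sum.delta' if_distrib cong: if_cong)
  finally have 1: "(\<Sum>d\<in>?D. moebius_mu d * ln (real (n div d))) = mangoldt n" .
  have "(\<Sum>d\<in>?D. moebius_mu d * ln (real (n div d))) = (\<Sum>d\<in>?D. moebius_mu d * (ln (real n) - ln (real d)))"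
  proof (intro sum.cong refl arg_cong2[where f = "(*)"])
    fix d assume "d \<in> ?D"
    then show "ln (real (n div d)) = ln (real n) - ln (real d)"
      using n by (auto simp: real_of_nat_div ln_div intro!: Nat.gr0I)
  qed
  also have "\<dots> = (\<Sum>d\<in>?D. moebius_mu d) * ln (real n) - (\<Sum>d\<in>?D. moebius_mu d * ln (real d))"
    by (simp add: right_diff_distrib sum_subtractf sum_distrib_right)
  \<comment> \<open>For n > 1 the first factor vanishes, for n = 1 the second.\<close>
  also have "(\<Sum>d\<in>?D. moebius_mu d) * ln (real n) = 0"
    using sum_moebius_divisors[OF n] by simp
  finally show ?thesis using 1 by simp
qed

text \<open>The sum of mu(d) \<open>N div d\<close> is exactly 1. Replacing each quotient by N/d
  changes a term by at most 1, so N times the sum is at most N + 1 in absolute value.\<close>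

lemma sum_moebius_over_n:
  assumes N: "N > 0"
  shows "\<bar>\<Sum>d=1..N. moebius_mu d / real d\<bar> \<le> 2"
proof -
  have "(\<Sum>d=1..N. moebius_mu d * real (N div d)) = (\<Sum>d=1..N. \<Sum>m=1..N div d. moebius_mu d)"
    by (simp add: mult.commute)
  also have "\<dots> = (\<Sum>n=1..N. \<Sum>d | d dvd n. moebius_mu d)"
    by (rule sum_divisors_swap[symmetric])
  also have "\<dots> = (\<Sum>n=1..N. if n = 1 then 1 else 0)"
    by (intro sum.cong refl sum_moebius_divisors) auto
  also have "\<dots> = 1" using N by simp
  finally have 1: "(\<Sum>d=1..N. moebius_mu d * real (N div d)) = 1" .
  have "\<bar>real N * (\<Sum>d=1..N. moebius_mu d / real d) - 1\<bar> =
      \<bar>\<Sum>d=1..N. moebius_mu d * (real N / real d - real (N div d))\<bar>"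
    unfolding 1[symmetric] by (simp add: sum_distrib_left right_diff_distrib sum_subtractf mult_ac)
  also have "\<dots> \<le> (\<Sum>d=1..N. \<bar>moebius_mu d * (real N / real d - real (N div d))\<bar>)"
    by (rule sum_abs)
  also have "\<dots> \<le> (\<Sum>d=1..N. 1 * 1)"
    unfolding abs_mult
  proof (intro sum_mono mult_mono abs_moebius_le)
    fix d show "\<bar>real N / real d - real (N div d)\<bar> \<le> 1"
      using floor_divide_of_nat_eq[where ?'a = real, of N d] by linarith
  qed auto
  finally have "\<bar>real N * (\<Sum>d=1..N. moebius_mu d / real d)\<bar> \<le> real N * 2"
    using N by simp
  then show ?thesis using N by (simp add: abs_mult)
qed

text \<open>Up to the constant g and an error O(d/N), ln(N/d) is \<open>harm (N div d)\<close>, and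
  with harmonic numbers in its place the sum collapses to 1 by Moebius inversion. The N errors, each
  weighted by 1/d, are at most C/N apiece.\<close>

lemma sum_moebius_ln_over_n:
  "\<exists>B. \<forall>N>0. \<bar>\<Sum>d=1..N. moebius_mu d / real d * ln (real N / real d)\<bar> \<le> B"
proof -
  obtain g C where gC: "\<And>x::real. x \<ge> 1 \<Longrightarrow> \<bar>harm (nat \<lfloor>x\<rfloor>) - ln x - g\<bar> \<le> C / x"
    using harm_asymptotics by blast
  have C: "C \<ge> 0" using order_trans[OF abs_ge_zero gC[of 1]] by simp
  have "\<bar>\<Sum>d=1..N. moebius_mu d / real d * ln (real N / real d)\<bar> \<le> 1 + 2 * \<bar>g\<bar> + C" if N: "N > 0" for N
  proof -
    have "(\<Sum>d=1..N. moebius_mu d / real d * harm (N div d)) =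
        (\<Sum>d=1..N. \<Sum>m=1..N div d. moebius_mu d / real (d * m))"
      by (simp add: harm_def sum_distrib_left divide_inverse mult_ac)
    also have "\<dots> = (\<Sum>n=1..N. \<Sum>d | d dvd n. moebius_mu d / real (d * (n div d)))"
      by (rule sum_divisors_swap[symmetric])
    also have "\<dots> = (\<Sum>n=1..N. (\<Sum>d | d dvd n. moebius_mu d) / real n)"
      by (intro sum.cong refl) (simp add: sum_divide_distrib)
    also have "\<dots> = (\<Sum>n=1..N. if n = 1 then 1 else 0)"
      by (intro sum.cong refl) (auto simp: sum_moebius_divisors)
    also have "\<dots> = 1" using N by simp
    finally have 1: "(\<Sum>d=1..N. moebius_mu d / real d * harm (N div d)) = 1" .
    define E where "E = (\<lambda>d. harm (N div d) - ln (real N / real d) - g)"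
    have "(\<Sum>d=1..N. moebius_mu d / real d * ln (real N / real d)) =
        (\<Sum>d=1..N. moebius_mu d / real d * harm (N div d)) - g * (\<Sum>d=1..N. moebius_mu d / real d)
          - (\<Sum>d=1..N. moebius_mu d / real d * E d)"
      unfolding sum_distrib_left sum_subtractf[symmetric]
      by (intro sum.cong refl) (simp add: E_def algebra_simps)
    then have "\<bar>\<Sum>d=1..N. moebius_mu d / real d * ln (real N / real d)\<bar> \<le>
        1 + \<bar>g\<bar> * \<bar>\<Sum>d=1..N. moebius_mu d / real d\<bar> + \<bar>\<Sum>d=1..N. moebius_mu d / real d * E d\<bar>"
      unfolding 1 abs_mult[symmetric] by linarith
    also have "\<bar>g\<bar> * \<bar>\<Sum>d=1..N. moebius_mu d / real d\<bar> \<le> \<bar>g\<bar> * 2"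
      by (intro mult_left_mono sum_moebius_over_n N) auto
    also have "\<bar>\<Sum>d=1..N. moebius_mu d / real d * E d\<bar> \<le> (\<Sum>d=1..N. C / real N)"
    proof (rule order_trans[OF sum_abs], rule sum_mono)
      fix d assume d: "d \<in> {1..N}"
      then have "real N / real d \<ge> 1" by simp
      from gC[OF this] have "\<bar>E d\<bar> \<le> C / (real N / real d)"
        by (simp add: E_def floor_divide_of_nat_eq)
      then have "\<bar>moebius_mu d / real d * E d\<bar> \<le> 1 / real d * (C / (real N / real d))"
        unfolding abs_mult by (intro mult_mono) (auto simp: abs_moebius_le divide_right_mono)
      also have "\<dots> = C / real N" using d N by simp
      finally show "\<bar>moebius_mu d / real d * E d\<bar> \<le> C / real N" .
    qed
    also have "(\<Sum>d=1..N. C / real N) = C" using N by simp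
    finally show ?thesis by simp
  qed
  then show ?thesis by blast
qed

section \<open>Non-vanishing on the 1-line\<close>

text \<open>\<open>osc_sum_const t Z\<close> characterises \<open>Z = \<zeta>(1 - it)\<close>.\<close>

definition osc_sum_const :: "real \<Rightarrow> complex \<Rightarrow> bool" where
  "osc_sum_const t Z \<longleftrightarrow>
     (\<exists>C. \<forall>x\<ge>1. norm (osc_sum t (nat \<lfloor>x\<rfloor>) - Z - osc t x / (\<i> * t)) \<le> C / x)"

lemma osc_sum_constE:
  assumes "osc_sum_const t Z"
  obtains C where "C \<ge> 0"
    and "\<And>N d. \<lbrakk>0 < d; d \<le> N\<rbrakk> \<Longrightarrow>
           norm (osc_sum t (N div d) - Z - osc t (real N / real d) / (\<i> * t)) \<le> C * real d / real N"
proof -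
  obtain C where C: "\<And>x. x \<ge> 1 \<Longrightarrow> norm (osc_sum t (nat \<lfloor>x\<rfloor>) - Z - osc t x / (\<i> * t)) \<le> C / x"
    using assms unfolding osc_sum_const_def by blast
  show ?thesis
  proof (rule that)
    show "C \<ge> 0" using order_trans[OF norm_ge_zero C[of 1]] by simp
    fix N d :: nat assume "0 < d" "d \<le> N"
    then show "norm (osc_sum t (N div d) - Z - osc t (real N / real d) / (\<i> * t)) \<le> C * real d / real N"
      using C[of "real N / real d"] by (simp add: floor_divide_of_nat_eq)
  qed
qed

text \<open>The discrete counterpart of integrating x^{it} ln x / x by parts, which yields x^{it} ln
  x / (it) plus a bounded term.\<close>

lemma sum_osc_ln:
  assumes Z: "osc_sum_const t Z" and t: "t \<noteq> 0"
  shows "\<exists>B. \<forall>N>0. norm ((\<Sum>n=1..N. osc t (real n) * of_real (ln (real n)) / of_nat n)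
                           - osc t (real N) * of_real (ln (real N)) / (\<i> * t)) \<le> B"
proof -
  obtain C where C: "C \<ge> 0" and rate: "\<And>N d. \<lbrakk>0 < d; d \<le> N\<rbrakk> \<Longrightarrow>
           norm (osc_sum t (N div d) - Z - osc t (real N / real d) / (\<i> * t)) \<le> C * real d / real N"
    using osc_sum_constE[OF Z] by blast
  define j where "j = \<i> * complex_of_real t"
  have j: "j \<noteq> 0" "norm j = \<bar>t\<bar>" using t by (auto simp: j_def norm_mult)
  define R where "R = (\<lambda>n::nat. osc_sum t n - Z - osc t (real n) / j)"
  have R: "norm (R n) \<le> C / real n" if "n > 0" for n
    using rate[of 1 n] that by (simp add: R_def j_def)
  define L where "L = (\<lambda>N. \<Sum>n=1..N. osc t (real n) * of_real (ln (real n)) / of_nat n)"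
  \<comment> \<open>Modelled on the antiderivative x^{it} ln x / j - x^{it}/j^2, with x^{it}/j
    replaced by \<open>osc_sum t n - Z\<close> or, up to a constant, by \<open>osc_sum t n\<close>.
    All terms with ln n then cancel exactly in the increments of D.\<close>
  define D where "D = (\<lambda>n. L n - (osc_sum t n - Z) * of_real (ln (real n)) + osc_sum t n / j)"
  have "norm (D (Suc n) - D n) \<le> (C + (\<bar>t\<bar> + 1) / \<bar>t\<bar>) / (real n)\<^sup>2" if n: "n > 0" for n
  proof -
    define h where "h = ln (real (Suc n)) - ln (real n)"
    have h: "0 \<le> h" "h \<le> 1 / real n" "\<bar>1 / real (Suc n) - h\<bar> \<le> 1 / (real n)\<^sup>2"
      using ln_Suc_diff_bounds(1,3)[OF n] n unfolding h_def by simp_all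
    define u where "u = osc t (real (Suc n)) / of_nat (Suc n)"
    have lnS: "ln (real (Suc n)) = ln (real n) + h" by (simp add: h_def)
    have "L (Suc n) = L n + u * of_real (ln (real n) + h)"
      by (simp add: L_def u_def flip: lnS)
    moreover have "osc_sum t (Suc n) = osc_sum t n + u" by (simp add: osc_sum_Suc u_def)
    moreover have "(u - osc t (real n) * of_real h) / j = u / j - osc t (real n) / j * of_real h"
      by (simp add: diff_divide_distrib)
    ultimately have "D (Suc n) - D n = (u - osc t (real n) * of_real h) / j - R n * of_real h"
      unfolding D_def lnS R_def by (simp add: algebra_simps add_divide_distrib)
    then have "norm (D (Suc n) - D n) \<le> norm ((u - osc t (real n) * of_real h) / j) + norm (R n * of_real h)"
      by (simp only: norm_triangle_ineq4)
    also have "norm (R n * of_real h) \<le> C / real n * (1 / real n)"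
      unfolding norm_mult norm_of_real using h R[OF n] C by (intro mult_mono) auto
    also have "norm ((u - osc t (real n) * of_real h) / j) \<le> (\<bar>t\<bar> / (real n)\<^sup>2 + 1 / (real n)\<^sup>2) / \<bar>t\<bar>"
    proof -
      have "u - osc t (real n) * of_real h =
          (osc t (real (Suc n)) - osc t (real n)) / of_nat (Suc n) + osc t (real n) * of_real (1 / real (Suc n) - h)"
        by (simp add: u_def diff_divide_distrib right_diff_distrib del: of_nat_Suc)
      then have "norm (u - osc t (real n) * of_real h) \<le>
          norm ((osc t (real (Suc n)) - osc t (real n)) / of_nat (Suc n)) + norm (osc t (real n) * of_real (1 / real (Suc n) - h))"
        by (simp only: norm_triangle_ineq)
      also have "norm (osc t (real n) * of_real (1 / real (Suc n) - h)) = \<bar>1 / real (Suc n) - h\<bar>"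
        by (simp only: norm_mult norm_osc norm_of_real mult_1)
      also have "\<dots> \<le> 1 / (real n)\<^sup>2" by (rule h)
      also have "norm ((osc t (real (Suc n)) - osc t (real n)) / of_nat (Suc n)) =
          norm (osc t (real (Suc n)) - osc t (real n)) / real (Suc n)"
        by (simp only: norm_divide norm_of_nat)
      also have "\<dots> \<le> (\<bar>t\<bar> * (1 / real n)) / real n"
      proof (rule frac_le)
        have "norm (osc t (real (Suc n)) - osc t (real n)) \<le> \<bar>t\<bar> * \<bar>h\<bar>"
          unfolding h_def by (rule norm_osc_diff_le)
        also have "\<dots> \<le> \<bar>t\<bar> * (1 / real n)" using h by (intro mult_left_mono) auto
        finally show "norm (osc t (real (Suc n)) - osc t (real n)) \<le> \<bar>t\<bar> * (1 / real n)" .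
      qed (use n in auto)
      finally show ?thesis
        unfolding norm_divide j(2) by (intro divide_right_mono) (auto simp: power2_eq_square)
    qed
    also have "(\<bar>t\<bar> / (real n)\<^sup>2 + 1 / (real n)\<^sup>2) / \<bar>t\<bar> + C / real n * (1 / real n) =
        (C + (\<bar>t\<bar> + 1) / \<bar>t\<bar>) / (real n)\<^sup>2"
      using t by (simp add: add_divide_distrib power2_eq_square mult_ac)
    finally show ?thesis by simp
  qed
  from bounded_of_quadratic_increments[OF this] obtain B where B: "\<And>n. n > 0 \<Longrightarrow> norm (D n) \<le> B" by blast
  have "norm (L N - osc t (real N) * of_real (ln (real N)) / j) \<le> B + C + (norm Z + 1 / \<bar>t\<bar> + C) / \<bar>t\<bar>"
    if N: "N > 0" for N
  proof -
    have RC: "norm (R N) \<le> C"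
      using R[OF N] C N divide_left_mono[of 1 "real N" C] by simp
    have "L N - osc t (real N) * of_real (ln (real N)) / j =
        D N + R N * of_real (ln (real N)) - (Z + osc t (real N) / j + R N) / j"
      by (simp add: D_def R_def algebra_simps add_divide_distrib)
    then have "norm (L N - osc t (real N) * of_real (ln (real N)) / j) \<le>
        norm (D N) + norm (R N * of_real (ln (real N))) + norm ((Z + osc t (real N) / j + R N) / j)"
      using norm_triangle_ineq4[of "D N + R N * of_real (ln (real N))" "(Z + osc t (real N) / j + R N) / j"]
        norm_triangle_ineq[of "D N" "R N * of_real (ln (real N))"] by (simp only:)
    \<comment> \<open>The crude bound ln N \<le> N suffices because \<open>R N\<close> is
      O(1/N).\<close>
    also have "norm (R N * of_real (ln (real N))) \<le> C / real N * real N"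
      unfolding norm_mult norm_of_real using R[OF N] C N ln_le_minus_one[of "real N"]
      by (intro mult_mono) auto
    also have "C / real N * real N = C" using N by simp
    also have "norm ((Z + osc t (real N) / j + R N) / j) \<le> (norm Z + 1 / \<bar>t\<bar> + C) / \<bar>t\<bar>"
      unfolding norm_divide j(2)
    proof (rule divide_right_mono)
      have "norm (osc t (real N) / j) = 1 / \<bar>t\<bar>" by (simp add: norm_divide j)
      then show "norm (Z + osc t (real N) / j + R N) \<le> norm Z + 1 / \<bar>t\<bar> + C"
        using norm_triangle_ineq[of "Z + osc t (real N) / j" "R N"]
          norm_triangle_ineq[of "Z" "osc t (real N) / j"] RC by linarith
    qed auto
    finally show ?thesis using B[OF N] by simp
  qed
  then show ?thesis unfolding L_def j_def by blast
qed

text \<open>Partial sums of the Dirichlet series of -zeta'/zeta at the point 1 - it.\<close>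

definition osc_mangoldt_sum :: "real \<Rightarrow> nat \<Rightarrow> complex" where
  "osc_mangoldt_sum t N = (\<Sum>n=1..N. mangoldt n * osc t (real n) / of_nat n)"

lemma osc_quotient:
  assumes "0 < d" "d dvd n" "0 < n"
  shows "osc t (real d) / of_nat d * (osc t (real (n div d)) / of_nat (n div d)) = osc t (real n) / of_nat n"
proof -
  obtain m where n: "n = d * m" using assms by blast
  then show ?thesis using assms by (simp add: osc_mult)
qed

lemma osc_mult_div:
  assumes "0 < d" "0 < N"
  shows "osc t (real d) * osc t (real N / real d) = osc t (real N)"
  using osc_mult[of "real d" "real N / real d" t] assms by simp

text \<open>Expand ln n in the sum of n^{it} ln n / n as a divisor sum of Lambda and insert the
  asymptotics of the inner sums. This gives Z times the wanted sum plus N^{it}/(it) times the sum of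
  Lambda(d)/d. By Mertens the latter matches the main term of \<open>sum_osc_ln\<close> up to O(1),
  so division by Z finishes.\<close>

lemma osc_mangoldt_sum_bounded_if_nonzero:
  assumes Z: "osc_sum_const t Z" and t: "t \<noteq> 0" and nz: "Z \<noteq> 0"
  shows "\<exists>B. \<forall>N>0. norm (osc_mangoldt_sum t N) \<le> B"
proof -
  obtain C where C: "C \<ge> 0" and rate: "\<And>N d. \<lbrakk>0 < d; d \<le> N\<rbrakk> \<Longrightarrow>
           norm (osc_sum t (N div d) - Z - osc t (real N / real d) / (\<i> * t)) \<le> C * real d / real N"
    using osc_sum_constE[OF Z] by blast
  define j where "j = \<i> * complex_of_real t"
  have j: "j \<noteq> 0" "norm j = \<bar>t\<bar>" using t by (auto simp: j_def norm_mult)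
  define L where "L = (\<lambda>N. \<Sum>n=1..N. osc t (real n) * of_real (ln (real n)) / of_nat n)"
  obtain B where B: "\<And>N. N > 0 \<Longrightarrow> norm (L N - osc t (real N) * of_real (ln (real N)) / j) \<le> B"
    using sum_osc_ln[OF Z t] unfolding L_def j_def by blast
  have "norm (osc_mangoldt_sum t N) \<le> (B + 4 / \<bar>t\<bar> + 4 * C) / norm Z" if N: "N > 0" for N
  proof -
    define E where "E = (\<lambda>d. osc_sum t (N div d) - Z - osc t (real N / real d) / j)"
    define M where "M = (\<Sum>d=1..N. mangoldt d / real d)"
    have M: "\<bar>M - ln (real N)\<bar> \<le> 4" unfolding M_def by (rule sum_mangoldt_over_n[OF N])
    have "L N = (\<Sum>n=1..N. \<Sum>d | d dvd n. mangoldt d * (osc t (real d) / of_nat d) * (osc t (real (n div d)) / of_nat (n div d)))"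
      unfolding L_def
    proof (intro sum.cong refl)
      fix n assume "n \<in> {1..N}"
      then have n: "n > 0" by simp
      have "osc t (real n) * of_real (ln (real n)) / of_nat n = (\<Sum>d | d dvd n. mangoldt d * (osc t (real n) / of_nat n))"
        using mangoldt_sum[of n, where ?'a = complex] n
        by (subst sum_distrib_right[symmetric]) (simp add: mult.commute)
      also have "\<dots> = (\<Sum>d | d dvd n. mangoldt d * (osc t (real d) / of_nat d) * (osc t (real (n div d)) / of_nat (n div d)))"
      proof (intro sum.cong refl)
        fix d assume d: "d \<in> {d. d dvd n}"
        then have "d > 0" using n by (auto intro!: Nat.gr0I)
        then show "mangoldt d * (osc t (real n) / of_nat n) =
            mangoldt d * (osc t (real d) / of_nat d) * (osc t (real (n div d)) / of_nat (n div d))"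
          using osc_quotient[of d n t] d n by (simp only: mult.assoc mem_Collect_eq)
      qed
      finally show "osc t (real n) * of_real (ln (real n)) / of_nat n = \<dots>" .
    qed
    also have "\<dots> = (\<Sum>d=1..N. \<Sum>m=1..N div d. mangoldt d * (osc t (real d) / of_nat d) * (osc t (real m) / of_nat m))"
      by (rule sum_divisors_swap)
    also have "\<dots> = (\<Sum>d=1..N. mangoldt d * (osc t (real d) / of_nat d) * osc_sum t (N div d))"
      by (simp add: osc_sum_def sum_distrib_left)
    \<comment> \<open>Since d^{it} (N/d)^{it} = N^{it}, the oscillation in the second term no longer
      depends on d.\<close>
    also have "\<dots> = (\<Sum>d=1..N. Z * (mangoldt d * osc t (real d) / of_nat d) +
        osc t (real N) / j * of_real (mangoldt d / real d) + mangoldt d * (osc t (real d) / of_nat d) * E d)"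
    proof (intro sum.cong refl)
      fix d assume d: "d \<in> {1..N}"
      have "osc_sum t (N div d) = Z + osc t (real N / real d) / j + E d" by (simp add: E_def)
      moreover have "osc t (real N) = osc t (real d) * osc t (real N / real d)"
        using osc_mult_div[of d N t] d by simp
      ultimately show "mangoldt d * (osc t (real d) / of_nat d) * osc_sum t (N div d) =
          Z * (mangoldt d * osc t (real d) / of_nat d) +
          osc t (real N) / j * of_real (mangoldt d / real d) + mangoldt d * (osc t (real d) / of_nat d) * E d"
        by (simp add: algebra_simps)
    qed
    also have "\<dots> = Z * osc_mangoldt_sum t N + osc t (real N) / j * of_real M +
        (\<Sum>d=1..N. mangoldt d * (osc t (real d) / of_nat d) * E d)"
      by (simp only: sum.distrib osc_mangoldt_sum_def M_def of_real_sum sum_distrib_left)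
    finally have "Z * osc_mangoldt_sum t N = (L N - osc t (real N) * of_real (ln (real N)) / j)
        - osc t (real N) / j * of_real (M - ln (real N))
        - (\<Sum>d=1..N. mangoldt d * (osc t (real d) / of_nat d) * E d)" (is "_ = ?a - ?b - ?c")
      by (simp add: algebra_simps)
    then have "norm (Z * osc_mangoldt_sum t N) \<le> norm ?a + norm ?b + norm ?c"
      using norm_triangle_ineq4[of "?a - ?b" ?c] norm_triangle_ineq4[of ?a ?b] by (simp only:)
    also have "norm ?a \<le> B" by (rule B[OF N])
    also have "norm ?b \<le> 1 / \<bar>t\<bar> * 4"
      unfolding norm_mult norm_divide norm_of_real norm_osc j(2) using M by (intro mult_left_mono) auto
    also have "norm ?c \<le> (\<Sum>d=1..N. mangoldt d * (C / real N))"
    proof (rule sum_norm_le)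
      fix d assume d: "d \<in> {1..N}"
      then have "norm (E d) \<le> C * real d / real N"
        unfolding E_def j_def by (intro rate) auto
      then have "norm (mangoldt d * (osc t (real d) / of_nat d) * E d) \<le> mangoldt d * (1 / real d) * (C * real d / real N)"
        unfolding norm_mult norm_divide norm_osc norm_of_nat norm_mangoldt
        using mangoldt_nonneg[of d] by (intro mult_left_mono) auto
      then show "norm (mangoldt d * (osc t (real d) / of_nat d) * E d) \<le> mangoldt d * (C / real N)"
        using d by simp
    qed
    also have "(\<Sum>d=1..N. mangoldt d * (C / real N)) = chebyshev_psi N * (C / real N)"
      by (simp add: chebyshev_psi_def sum_distrib_right sum_divide_distrib)
    \<comment> \<open>Chebyshev's bound makes the accumulated error O(1); Mertens' estimate alone
      would not.\<close>
    also have "\<dots> \<le> (4 * real N) * (C / real N)"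
      using C by (intro mult_right_mono chebyshev_psi_le) auto
    also have "\<dots> = 4 * C" using N by simp
    finally show ?thesis using nz by (simp add: norm_mult field_simps)
  qed
  then show ?thesis by blast
qed

text \<open>With Z = 0 the inner sums are just (N/d)^{it}/(it) + O(d/N). Weighting them by mu(d)
  ln(N/d) d^{it}/d leaves as main term N^{it}/(it) times the sum in
  \<open>sum_moebius_ln_over_n\<close>, which is bounded.\<close>

lemma osc_mangoldt_sum_if_zero:
  assumes Z: "osc_sum_const t 0" and t: "t \<noteq> 0"
  shows "\<exists>B. \<forall>N>0. norm (osc_mangoldt_sum t N + of_real (ln (real N))) \<le> B"
proof -
  obtain C where C: "C \<ge> 0" and rate: "\<And>N d. \<lbrakk>0 < d; d \<le> N\<rbrakk> \<Longrightarrow>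
           norm (osc_sum t (N div d) - 0 - osc t (real N / real d) / (\<i> * t)) \<le> C * real d / real N"
    using osc_sum_constE[OF Z] by blast
  define j where "j = \<i> * complex_of_real t"
  have j: "j \<noteq> 0" "norm j = \<bar>t\<bar>" using t by (auto simp: j_def norm_mult)
  obtain B where B: "\<And>N. N > 0 \<Longrightarrow> \<bar>\<Sum>d=1..N. moebius_mu d / real d * ln (real N / real d)\<bar> \<le> B"
    using sum_moebius_ln_over_n by blast
  have "norm (osc_mangoldt_sum t N + of_real (ln (real N))) \<le> 1 / \<bar>t\<bar> * B + C" if N: "N > 0" for N
  proof -
    define E where "E = (\<lambda>d. osc_sum t (N div d) - osc t (real N / real d) / j)"
    \<comment> \<open>The logarithm contains N rather than n, so the divisor sum of \<open>w\<close>
      is Lambda(n) plus an extra ln N at n = 1. This is the source of the ln N in the claim.\<close>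
    define w where "w = (\<lambda>d. moebius_mu d * ln (real N / real d))"
    have inner: "(\<Sum>d | d dvd n. w d) = (if n = 1 then ln (real N) else 0) + mangoldt n" if n: "n > 0" for n
    proof -
      have "(\<Sum>d | d dvd n. w d) = (\<Sum>d | d dvd n. moebius_mu d * ln (real N) - moebius_mu d * ln (real d))"
      proof (intro sum.cong refl)
        fix d assume "d \<in> {d. d dvd n}"
        then have "d > 0" using n by (auto intro!: Nat.gr0I)
        then show "w d = moebius_mu d * ln (real N) - moebius_mu d * ln (real d)"
          using N by (simp add: w_def ln_div right_diff_distrib)
      qed
      also have "\<dots> = (\<Sum>d | d dvd n. moebius_mu d) * ln (real N) + mangoldt n"
        using sum_moebius_ln_divisors[OF n] by (simp add: sum_subtractf sum_distrib_right)
      finally show ?thesis using sum_moebius_divisors[OF n] by simp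
    qed
    have "osc_mangoldt_sum t N + of_real (ln (real N)) =
        (\<Sum>n=1..N. mangoldt n * osc t (real n) / of_nat n + (if n = 1 then of_real (ln (real N)) else 0))"
      using N by (simp add: osc_mangoldt_sum_def sum.distrib)
    also have "\<dots> = (\<Sum>n=1..N. of_real (\<Sum>d | d dvd n. w d) * (osc t (real n) / of_nat n))"
      by (intro sum.cong refl) (auto simp: inner distrib_right simp del: of_real_sum)
    also have "\<dots> = (\<Sum>n=1..N. \<Sum>d | d dvd n. of_real (w d) * (osc t (real d) / of_nat d) * (osc t (real (n div d)) / of_nat (n div d)))"
      unfolding of_real_sum sum_distrib_right
    proof (intro sum.cong refl)
      fix n d assume "n \<in> {1..N}" and d: "d \<in> {d. d dvd n}"
      then have n: "n > 0" by simp
      with d have "d > 0" by (auto intro!: Nat.gr0I)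
      then show "complex_of_real (w d) * (osc t (real n) / of_nat n) =
          of_real (w d) * (osc t (real d) / of_nat d) * (osc t (real (n div d)) / of_nat (n div d))"
        using osc_quotient[of d n t] d n by (simp only: mult.assoc mem_Collect_eq)
    qed
    also have "\<dots> = (\<Sum>d=1..N. \<Sum>m=1..N div d. of_real (w d) * (osc t (real d) / of_nat d) * (osc t (real m) / of_nat m))"
      by (rule sum_divisors_swap)
    also have "\<dots> = (\<Sum>d=1..N. of_real (w d) * (osc t (real d) / of_nat d) * osc_sum t (N div d))"
      by (simp add: osc_sum_def sum_distrib_left)
    also have "\<dots> = (\<Sum>d=1..N. osc t (real N) / j * of_real (moebius_mu d / real d * ln (real N / real d)) +
        of_real (w d) * (osc t (real d) / of_nat d) * E d)"
    proof (intro sum.cong refl)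
      fix d assume d: "d \<in> {1..N}"
      have "osc_sum t (N div d) = osc t (real N / real d) / j + E d" by (simp add: E_def)
      moreover have "osc t (real N) = osc t (real d) * osc t (real N / real d)"
        using osc_mult_div[of d N t] d by simp
      ultimately show "of_real (w d) * (osc t (real d) / of_nat d) * osc_sum t (N div d) =
          osc t (real N) / j * of_real (moebius_mu d / real d * ln (real N / real d)) +
          of_real (w d) * (osc t (real d) / of_nat d) * E d"
        by (simp add: w_def algebra_simps add_divide_distrib)
    qed
    also have "\<dots> = osc t (real N) / j * of_real (\<Sum>d=1..N. moebius_mu d / real d * ln (real N / real d)) +
        (\<Sum>d=1..N. of_real (w d) * (osc t (real d) / of_nat d) * E d)" (is "_ = ?b + ?c")
      by (simp only: sum.distrib of_real_sum sum_distrib_left)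
    finally have "norm (osc_mangoldt_sum t N + of_real (ln (real N))) \<le> norm ?b + norm ?c"
      by (simp only: norm_triangle_ineq)
    also have "norm ?b \<le> 1 / \<bar>t\<bar> * B"
      unfolding norm_mult norm_divide norm_of_real norm_osc j(2) using B[OF N] by (intro mult_left_mono) auto
    also have "norm ?c \<le> (\<Sum>d=1..N. (ln (real N) - ln (real d)) * (C / real N))"
    proof (rule sum_norm_le)
      fix d assume d: "d \<in> {1..N}"
      then have "norm (E d) \<le> C * real d / real N"
        unfolding E_def j_def using rate[of d N] by simp
      moreover have "\<bar>w d\<bar> \<le> 1 * (ln (real N) - ln (real d))"
        unfolding w_def abs_mult using d by (intro mult_mono abs_moebius_le) (auto simp: ln_div)
      moreover have "0 \<le> ln (real N) - ln (real d)" using d by simp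
      ultimately have "norm (of_real (w d) * (osc t (real d) / of_nat d) * E d) \<le>
          (1 * (ln (real N) - ln (real d))) * (1 / real d) * (C * real d / real N)"
        unfolding norm_mult norm_divide norm_osc norm_of_nat norm_of_real
        by (intro mult_mono) auto
      then show "norm (of_real (w d) * (osc t (real d) / of_nat d) * E d) \<le> (ln (real N) - ln (real d)) * (C / real N)"
        using d by simp
    qed
    \<comment> \<open>The errors carry the factor ln(N/d), but its sum over d is N ln N - ln N!, at
      most N by the weak Stirling bound.\<close>
    also have "\<dots> = (real N * ln (real N) - ln (fact N)) * (C / real N)"
    proof -
      have "ln (fact N :: real) = (\<Sum>n=1..N. ln (real n))"
        by (induction N) (auto simp: ln_mult)
      then show ?thesis by (simp only: sum_distrib_right[symmetric] sum_subtractf) simp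
    qed
    also have "\<dots> \<le> real N * (C / real N)"
      using C ln_fact_bounds(1)[OF N] by (intro mult_right_mono) auto
    also have "\<dots> = C" using N by simp
    finally show ?thesis by simp
  qed
  then show ?thesis by blast
qed

lemma three_four_one_nonneg: "0 \<le> 3 + 4 * cos x + cos (2 * x :: real)"
proof -
  have "3 + 4 * cos x + cos (2 * x) = 2 * (1 + cos x)\<^sup>2"
    unfolding cos_double_cos by (simp add: power2_eq_square algebra_simps)
  then show ?thesis by simp
qed

text \<open>If Z = 0, weighting the inequality 3 + 4 cos x + cos 2x \<ge> 0 by Lambda(n)/n at x = t
  ln n gives 0 \<le> 3 ln N - 4 ln N + O(1), which is false for large N.\<close>

lemma osc_sum_const_nonzero:
  assumes Z: "osc_sum_const t Z" and t: "t \<noteq> 0"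
  shows "Z \<noteq> 0"
proof
  assume "Z = 0"
  then obtain B1 where B1: "\<And>N. N > 0 \<Longrightarrow> norm (osc_mangoldt_sum t N + of_real (ln (real N))) \<le> B1"
    using osc_mangoldt_sum_if_zero[of t] assms by blast
  have t2: "2 * t \<noteq> 0" using t by simp
  obtain W where W: "osc_sum_const (2 * t) W"
    using osc_sum_asymptotics[OF t2] unfolding osc_sum_const_def by blast
  \<comment> \<open>Only an upper bound is needed at 2t, so a zero there does no harm: the sum would
    then be -ln N + O(1).\<close>
  have "\<exists>B2. \<forall>N>0. Re (osc_mangoldt_sum (2 * t) N) \<le> B2"
  proof (cases "W = 0")
    case False
    from osc_mangoldt_sum_bounded_if_nonzero[OF W t2 False] show ?thesis
      using complex_Re_le_cmod order_trans by blast
  next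
    case True
    with W have "osc_sum_const (2 * t) 0" by simp
    from osc_mangoldt_sum_if_zero[OF this t2] obtain B2
      where B2: "\<And>N. N > 0 \<Longrightarrow> norm (osc_mangoldt_sum (2 * t) N + of_real (ln (real N))) \<le> B2" by blast
    have "Re (osc_mangoldt_sum (2 * t) N) \<le> B2" if N: "N > 0" for N
    proof -
      have "Re (osc_mangoldt_sum (2 * t) N) \<le> Re (osc_mangoldt_sum (2 * t) N + of_real (ln (real N)))"
        using N by simp
      also have "\<dots> \<le> B2" using B2[OF N] complex_Re_le_cmod order_trans by blast
      finally show ?thesis .
    qed
    then show ?thesis by blast
  qed
  then obtain B2 where B2: "\<And>N. N > 0 \<Longrightarrow> Re (osc_mangoldt_sum (2 * t) N) \<le> B2" by blast
  have Re_sum: "Re (osc_mangoldt_sum s N) = (\<Sum>n=1..N. mangoldt n / real n * cos (s * ln (real n)))" for s N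
    by (simp add: osc_mangoldt_sum_def osc_def)
  \<comment> \<open>The 12 is three times the error 4 in Mertens' estimate.\<close>
  have "ln (real N) \<le> 12 + 4 * B1 + B2" if N: "N > 0" for N
  proof -
    have "0 \<le> (\<Sum>n=1..N. mangoldt n / real n * (3 + 4 * cos (t * ln (real n)) + cos (2 * (t * ln (real n)))))"
      by (intro sum_nonneg mult_nonneg_nonneg divide_nonneg_nonneg mangoldt_nonneg three_four_one_nonneg) auto
    also have "\<dots> = 3 * (\<Sum>n=1..N. mangoldt n / real n) + 4 * Re (osc_mangoldt_sum t N) + Re (osc_mangoldt_sum (2 * t) N)"
      by (simp add: Re_sum distrib_left sum.distrib sum_distrib_left mult_ac)
    finally have "0 \<le> 3 * (\<Sum>n=1..N. mangoldt n / real n) + 4 * Re (osc_mangoldt_sum t N) + Re (osc_mangoldt_sum (2 * t) N)" .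
    moreover have "Re (osc_mangoldt_sum t N) + ln (real N) \<le> B1"
      using order_trans[OF complex_Re_le_cmod B1[OF N]] by simp
    ultimately show ?thesis using sum_mangoldt_over_n[OF N] B2[OF N] by linarith
  qed
  note bound = this
  obtain N :: nat where "exp (12 + 4 * B1 + B2) < real N" using reals_Archimedean2 by blast
  moreover from this have "N > 0" using exp_gt_zero[of "12 + 4 * B1 + B2"] by (auto intro!: Nat.gr0I simp del: exp_gt_zero)
  ultimately show False using bound[of N] by (metis exp_gt_zero exp_le_cancel_iff exp_ln leD of_nat_0_less_iff)
qed

lemma osc_mangoldt_sum_bounded:
  assumes "t \<noteq> 0"
  shows "\<exists>B. \<forall>N>0. norm (osc_mangoldt_sum t N) \<le> B"
proof -
  obtain Z where "osc_sum_const t Z"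
    using osc_sum_asymptotics[OF assms] unfolding osc_sum_const_def by blast
  then show ?thesis
    using osc_mangoldt_sum_bounded_if_nonzero osc_sum_const_nonzero assms by blast
qed

section \<open>Primes in every direction\<close>

lemma ln_le_two_sqrt:
  assumes "x > 0"
  shows "ln x \<le> 2 * sqrt x"
  using ln_le_minus_one[of "sqrt x"] assms by (simp add: ln_sqrt)

lemma sum_power_from_two_le:
  assumes "0 \<le> r" "r \<le> 1 / (2::real)"
  shows "(\<Sum>k=2..N. r ^ k) \<le> 2 * r\<^sup>2"
proof -
  \<comment> \<open>The additional term \<open>2 * r ^ Suc N\<close> makes the induction close: half
    of it is the next power, and 2r \<le> 1 lets the other half pay for the new additional
    term.\<close>
  have "(\<Sum>k=2..N. r ^ k) + 2 * r ^ Suc N \<le> 2 * r\<^sup>2" if "N \<ge> 1"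
    using that
  proof (induction N rule: nat_induct_at_least)
    case base
    then show ?case by (simp add: power2_eq_square)
  next
    case (Suc n)
    have "2 * r ^ Suc (Suc n) \<le> r ^ Suc n"
      using mult_right_mono[OF assms(2), of "2 * r ^ Suc n"] assms(1) by simp
    with Suc show ?case by simp
  qed
  moreover have "0 \<le> r ^ Suc N" using assms by simp
  ultimately show ?thesis by (cases "N \<ge> 1") auto
qed

text \<open>The powers p^k with k \<ge> 2 contribute at most 2 ln p / p^2 for each prime p, and ln p
  \<le> 2 sqrt p turns this into a multiple of the summable p^{-3/2}.\<close>

lemma sum_mangoldt_nonprime_bounded:
  "\<exists>B. \<forall>N. (\<Sum>n\<in>{n\<in>{1..N}. \<not> prime n}. mangoldt n / real n) \<le> B"
proof -
  define g where "g = (\<lambda>p::nat. real p powr (-3/2))"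
  have g: "summable g" unfolding g_def by (subst summable_real_powr_iff) auto
  have "(\<Sum>n\<in>{n\<in>{1..N}. \<not> prime n}. mangoldt n / real n) \<le> 4 * suminf g" for N
  proof -
    define P where "P = {p\<in>{2..N}. prime p}"
    define pow where "pow = (\<lambda>(p::nat, k::nat). p ^ k)"
    define Q where "Q = {n\<in>{1..N}. primepow n \<and> \<not> prime n}"
    have sub: "Q \<subseteq> pow ` (P \<times> {2..N})"
    proof
      fix n assume n: "n \<in> Q"
      then obtain p k where pk: "prime p" "k > 0" "n = p ^ k"
        unfolding Q_def primepow_def by auto
      have "k \<noteq> 1" using n pk by (auto simp: Q_def)
      have "p \<ge> 2" using pk prime_ge_2_nat by blast
      have "k < 2 ^ k" by simp
      also have "\<dots> \<le> p ^ k" using \<open>p \<ge> 2\<close> by (intro power_mono) auto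
      also have "\<dots> \<le> N" using n pk by (auto simp: Q_def)
      finally have "k \<le> N" by simp
      have "p ^ 1 \<le> p ^ k" using pk \<open>p \<ge> 2\<close> by (intro power_increasing) auto
      then have "p \<le> N" using n pk by (auto simp: Q_def)
      then have "(p, k) \<in> P \<times> {2..N}"
        using pk \<open>k \<noteq> 1\<close> \<open>p \<ge> 2\<close> \<open>k \<le> N\<close> by (auto simp: P_def)
      moreover have "n = pow (p, k)" by (simp add: pow_def pk)
      ultimately show "n \<in> pow ` (P \<times> {2..N})" by blast
    qed
    have "(\<Sum>n\<in>{n\<in>{1..N}. \<not> prime n}. mangoldt n / real n) = (\<Sum>n\<in>Q. mangoldt n / real n)"
      by (intro sum.mono_neutral_right) (auto simp: Q_def mangoldt_def)
    also have "\<dots> \<le> (\<Sum>n\<in>pow ` (P \<times> {2..N}). mangoldt n / real n)"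
      by (intro sum_mono2 sub) (auto simp: P_def mangoldt_nonneg)
    \<comment> \<open>An inequality is enough here, so injectivity of (p, k) \<mapsto> p^k need not
      be shown.\<close>
    also have "\<dots> \<le> (\<Sum>x\<in>P \<times> {2..N}. mangoldt (pow x) / real (pow x))"
      using sum_image_le[of "P \<times> {2..N}" "\<lambda>n. mangoldt n / real n" pow]
      by (auto simp: P_def mangoldt_nonneg o_def)
    also have "\<dots> = (\<Sum>p\<in>P. \<Sum>k=2..N. mangoldt (p ^ k) / real (p ^ k))"
      by (simp add: sum.cartesian_product pow_def case_prod_unfold)
    also have "\<dots> \<le> (\<Sum>p\<in>P. 4 * g p)"
    proof (rule sum_mono)
      fix p assume "p \<in> P"
      then have p: "prime p" "real p \<ge> 2" by (auto simp: P_def)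
      have "(\<Sum>k=2..N. mangoldt (p ^ k) / real (p ^ k)) = ln (real p) * (\<Sum>k=2..N. (1 / real p) ^ k)"
        unfolding sum_distrib_left using p by (intro sum.cong refl) (auto simp: power_divide)
      also have "\<dots> \<le> (2 * sqrt (real p)) * (2 * (1 / real p)\<^sup>2)"
        using p by (intro mult_mono ln_le_two_sqrt sum_power_from_two_le sum_nonneg) (auto simp: field_simps)
      also have "\<dots> = 4 * g p"
      proof -
        have "sqrt (real p) / (real p)\<^sup>2 = real p powr (1/2) / real p powr 2"
          using p by (simp add: powr_half_sqrt)
        also have "\<dots> = real p powr (-3/2)" unfolding powr_diff[symmetric] by simp
        finally show ?thesis by (simp add: g_def power_divide)
      qed
      finally show "(\<Sum>k=2..N. mangoldt (p ^ k) / real (p ^ k)) \<le> 4 * g p" .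
    qed
    also have "\<dots> = 4 * (\<Sum>p\<in>P. g p)" by (simp add: sum_distrib_left)
    also have "(\<Sum>p\<in>P. g p) \<le> suminf g"
      by (intro sum_le_suminf g) (auto simp: P_def g_def)
    finally show ?thesis by simp
  qed
  then show ?thesis by blast
qed

definition osc_prime_sum :: "real \<Rightarrow> nat \<Rightarrow> complex" where
  "osc_prime_sum t N = (\<Sum>p\<in>{p\<in>{1..N}. prime p}. of_real (ln (real p) / real p) * osc t (real p))"

text \<open>The discarded terms are estimated in absolute value, hence uniformly in t; the case t =
  0 yields Mertens' estimate over primes.\<close>

lemma osc_prime_sum_approx:
  "\<exists>B. \<forall>t N. norm (osc_mangoldt_sum t N - osc_prime_sum t N) \<le> B"
proof -
  obtain B where B: "\<And>N. (\<Sum>n\<in>{n\<in>{1..N}. \<not> prime n}. mangoldt n / real n) \<le> B"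
    using sum_mangoldt_nonprime_bounded by blast
  have "norm (osc_mangoldt_sum t N - osc_prime_sum t N) \<le> B" for t N
  proof -
    have "osc_mangoldt_sum t N = (\<Sum>n\<in>{n\<in>{1..N}. prime n} \<union> {n\<in>{1..N}. \<not> prime n}. mangoldt n * osc t (real n) / of_nat n)"
      unfolding osc_mangoldt_sum_def by (intro sum.cong) auto
    also have "\<dots> = (\<Sum>n\<in>{n\<in>{1..N}. prime n}. mangoldt n * osc t (real n) / of_nat n) +
        (\<Sum>n\<in>{n\<in>{1..N}. \<not> prime n}. mangoldt n * osc t (real n) / of_nat n)"
      by (intro sum.union_disjoint) auto
    also have "(\<Sum>n\<in>{n\<in>{1..N}. prime n}. mangoldt n * osc t (real n) / of_nat n) = osc_prime_sum t N"
      unfolding osc_prime_sum_def by (intro sum.cong) auto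
    finally have "norm (osc_mangoldt_sum t N - osc_prime_sum t N) =
        norm (\<Sum>n\<in>{n\<in>{1..N}. \<not> prime n}. mangoldt n * osc t (real n) / of_nat n)" by simp
    also have "\<dots> \<le> (\<Sum>n\<in>{n\<in>{1..N}. \<not> prime n}. mangoldt n / real n)"
      by (rule sum_norm_le) (simp add: norm_mult norm_divide)
    also have "\<dots> \<le> B" by (rule B)
    finally show ?thesis .
  qed
  then show ?thesis by blast
qed

lemma osc_prime_sum_bounded:
  assumes "t \<noteq> 0"
  shows "\<exists>B. \<forall>N>0. norm (osc_prime_sum t N) \<le> B"
proof -
  obtain B1 where B1: "\<And>t N. norm (osc_mangoldt_sum t N - osc_prime_sum t N) \<le> B1"
    using osc_prime_sum_approx by blast
  obtain B2 where B2: "\<And>N. N > 0 \<Longrightarrow> norm (osc_mangoldt_sum t N) \<le> B2"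
    using osc_mangoldt_sum_bounded[OF assms] by blast
  have "norm (osc_prime_sum t N) \<le> B1 + B2" if "N > 0" for N
    using B1[of t N] B2[OF that] norm_triangle_ineq3[of "osc_mangoldt_sum t N" "osc_prime_sum t N"] by linarith
  then show ?thesis by blast
qed

lemma sum_primes_ln_over_p:
  "\<exists>B. \<forall>N>0. \<bar>(\<Sum>p\<in>{p\<in>{1..N}. prime p}. ln (real p) / real p) - ln (real N)\<bar> \<le> B"
proof -
  obtain B where B: "\<And>t N. norm (osc_mangoldt_sum t N - osc_prime_sum t N) \<le> B"
    using osc_prime_sum_approx by blast
  have "\<bar>(\<Sum>p\<in>{p\<in>{1..N}. prime p}. ln (real p) / real p) - ln (real N)\<bar> \<le> B + 4" if N: "N > 0" for N
  proof -
    have "osc_mangoldt_sum 0 N = of_real (\<Sum>n=1..N. mangoldt n / real n)"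
      by (simp add: osc_mangoldt_sum_def osc_def)
    moreover have "osc_prime_sum 0 N = of_real (\<Sum>p\<in>{p\<in>{1..N}. prime p}. ln (real p) / real p)"
      by (simp add: osc_prime_sum_def osc_def)
    ultimately have "\<bar>(\<Sum>n=1..N. mangoldt n / real n) - (\<Sum>p\<in>{p\<in>{1..N}. prime p}. ln (real p) / real p)\<bar> \<le> B"
      using B[of 0 N] by (simp only: of_real_diff[symmetric] norm_of_real)
    then show ?thesis using sum_mangoldt_over_n[OF N] by linarith
  qed
  then show ?thesis by blast
qed

lemma Re_power2_unit:
  assumes "norm z = 1"
  shows "(Re z)\<^sup>2 = (1 + Re (z\<^sup>2)) / 2"
proof -
  have "(Re z)\<^sup>2 + (Im z)\<^sup>2 = 1" using assms cmod_power2[of z] by simp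
  then show ?thesis by (simp add: power2_eq_square)
qed

text \<open>With weights ln p / p, the values s = Re (u p^{ib}) have sum O(1) and sum of squares (ln
  K)/2 + O(1), against total weight ln K + O(1). Hence those with s \<ge> 1/8 carry weight at least
  1. K is fixed before R because the number of primes required later depends on K.\<close>

lemma primes_in_every_direction:
  assumes b: "b \<noteq> 0"
  shows "\<exists>K>1. \<forall>R::nat. \<exists>X. \<forall>x\<ge>X. \<forall>u. norm u = 1 \<longrightarrow>
           R \<le> card {p. prime p \<and> x < real p \<and> real p \<le> K * x \<and> 1 / 8 \<le> Re (u * osc b (real p))}"
proof -
  obtain B1 where B1: "\<And>N. N > 0 \<Longrightarrow> norm (osc_prime_sum b N) \<le> B1"
    using osc_prime_sum_bounded[OF b] by blast
  obtain B2 where B2: "\<And>N. N > 0 \<Longrightarrow> norm (osc_prime_sum (2 * b) N) \<le> B2"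
    using osc_prime_sum_bounded[of "2 * b"] b by auto
  obtain B0 where B0: "\<And>N. N > 0 \<Longrightarrow>
      \<bar>(\<Sum>p\<in>{p\<in>{1..N}. prime p}. ln (real p) / real p) - ln (real N)\<bar> \<le> B0"
    using sum_primes_ln_over_p by blast
  define B where "B = max B0 (max B1 B2)"
  have B: "B \<ge> 0" using order_trans[OF norm_ge_zero B1[of 1]] by (simp add: B_def)
  \<comment> \<open>The moment estimates below give the good primes weight at least (ln K)/8 - 9B/4,
    which this choice makes at least 1.\<close>
  obtain K :: nat where K: "exp (8 + 24 * B) < real K" using reals_Archimedean2 by blast
  have "1 < exp (8 + 24 * B)" using B by simp
  with K have K1: "real K > 1" by linarith
  have lnK: "8 + 24 * B \<le> ln (real K)"
    using K K1 by (subst ln_ge_iff) auto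
  have "R \<le> card {p. prime p \<and> x < real p \<and> real p \<le> real K * x \<and> 1 / 8 \<le> Re (u * osc b (real p))}"
    if x: "x \<ge> 4 * (real R)\<^sup>2 + 2" and u: "norm u = 1" for R :: nat and x u
  proof -
    define N where "N = nat \<lfloor>x\<rfloor>"
    have x1: "x \<ge> 1" using x by (smt (verit) zero_le_power2)
    have N: "real N \<le> x" "x < real N + 1" "N > 0" unfolding N_def using x1 by linarith+
    have KN: "K * N > 0" "N \<le> K * N" using N K1 by auto
    \<comment> \<open>The integer range from N + 1 to K N lies in (x, K x], as N \<le> x < N + 1,
      and turns sums over J into differences of sums up to K N and up to N.\<close>
    define J where "J = {p\<in>{Suc N..K * N}. prime p}"
    define w where "w = (\<lambda>p::nat. ln (real p) / real p)"
    define s where "s = (\<lambda>p::nat. Re (u * osc b (real p)))"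
    define G where "G = {p\<in>J. 1 / 8 \<le> s p}"
    have finJ: "finite J" by (simp add: J_def)
    have w0: "w p \<ge> 0" for p by (cases "p = 0") (auto simp: w_def)
    have Jeq: "J = {p\<in>{1..K * N}. prime p} - {p\<in>{1..N}. prime p}"
      using prime_gt_0_nat by (auto simp: J_def Suc_le_eq)
    have diff: "(\<Sum>p\<in>J. f p) = (\<Sum>p\<in>{p\<in>{1..K * N}. prime p}. f p) - (\<Sum>p\<in>{p\<in>{1..N}. prime p}. f p)"
      for f :: "nat \<Rightarrow> 'c :: ab_group_add"
      unfolding Jeq by (subst sum_diff) (auto intro: order_trans[OF _ KN(2)])
    define V where "V = (\<lambda>t. \<Sum>p\<in>J. of_real (w p) * osc t (real p))"
    have V: "norm (V t) \<le> 2 * B" if "t = b \<or> t = 2 * b" for t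
    proof -
      have "V t = osc_prime_sum t (K * N) - osc_prime_sum t N"
        unfolding V_def w_def osc_prime_sum_def by (rule diff)
      then have "norm (V t) \<le> norm (osc_prime_sum t (K * N)) + norm (osc_prime_sum t N)"
        by (simp only: norm_triangle_ineq4)
      also have "\<dots> \<le> B + B"
        using that B1[OF KN(1)] B1[OF N(3)] B2[OF KN(1)] B2[OF N(3)]
        by (intro add_mono) (auto simp: B_def)
      finally show ?thesis by simp
    qed
    have V0: "\<bar>(\<Sum>p\<in>J. w p) - ln (real K)\<bar> \<le> 2 * B"
    proof -
      have "ln (real (K * N)) = ln (real K) + ln (real N)"
        using N K1 by (simp add: ln_mult)
      moreover have "B0 \<le> B" by (simp add: B_def)
      ultimately show ?thesis
        unfolding w_def diff using B0[OF KN(1)] B0[OF N(3)] by linarith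
    qed
    have "(\<Sum>p\<in>J. w p * s p) = Re (u * V b)"
      by (simp add: V_def s_def sum_distrib_left algebra_simps sum_subtractf)
    moreover have "\<bar>Re (u * V b)\<bar> \<le> 2 * B"
      using abs_Re_le_cmod[of "u * V b"] V[of b] u by (simp add: norm_mult)
    ultimately have S1: "(\<Sum>p\<in>J. w p * s p) \<ge> - 2 * B" by linarith
    have sq: "(s p)\<^sup>2 = (1 + Re (u\<^sup>2 * osc (2 * b) (real p))) / 2" for p
    proof -
      have "(osc b (real p))\<^sup>2 = osc (2 * b) (real p)"
        by (simp add: osc_def power2_eq_square cis_mult mult.assoc)
      then show ?thesis
        unfolding s_def using u by (subst Re_power2_unit) (auto simp: norm_mult power_mult_distrib)
    qed
    have "2 * (\<Sum>p\<in>J. w p * (s p)\<^sup>2) = (\<Sum>p\<in>J. w p) + (\<Sum>p\<in>J. w p * Re (u\<^sup>2 * osc (2 * b) (real p)))"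
      unfolding sq sum_distrib_left sum.distrib[symmetric] by (intro sum.cong refl) (simp add: distrib_left)
    also have "(\<Sum>p\<in>J. w p * Re (u\<^sup>2 * osc (2 * b) (real p))) = Re (u\<^sup>2 * V (2 * b))"
      by (simp add: V_def sum_distrib_left right_diff_distrib sum_subtractf mult_ac)
    finally have "2 * (\<Sum>p\<in>J. w p * (s p)\<^sup>2) = (\<Sum>p\<in>J. w p) + Re (u\<^sup>2 * V (2 * b))" .
    moreover have "\<bar>Re (u\<^sup>2 * V (2 * b))\<bar> \<le> 2 * B"
      using abs_Re_le_cmod[of "u\<^sup>2 * V (2 * b)"] V[of "2 * b"] u by (simp add: norm_mult norm_power)
    ultimately have S2: "2 * (\<Sum>p\<in>J. w p * (s p)\<^sup>2) \<ge> ln (real K) - 4 * B" using V0 by linarith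
    have sbound: "\<bar>s p\<bar> \<le> 1" for p
      using abs_Re_le_cmod[of "u * osc b (real p)"] u by (simp add: s_def norm_mult)
    have "(\<Sum>p\<in>J. w p * (s p)\<^sup>2) + (\<Sum>p\<in>J. w p * s p) =
        (\<Sum>p\<in>J. w p * ((s p)\<^sup>2 + s p))"
      by (simp add: sum.distrib distrib_left)
    \<comment> \<open>Below 1/8 the value s^2 + s is at most 0 for negative s and at most 2s \<le>
      1/4 otherwise; on G it is at most 2 since |s| \<le> 1.\<close>
    also have "\<dots> \<le> (\<Sum>p\<in>J. w p * (1 / 4 + (if p \<in> G then 2 else 0)))"
    proof (intro sum_mono mult_left_mono w0)
      fix p assume p: "p \<in> J"
      have sp: "(s p)\<^sup>2 \<le> \<bar>s p\<bar>"
        using mult_left_mono[OF sbound[of p], of "\<bar>s p\<bar>"] by (simp add: power2_eq_square)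
      show "(s p)\<^sup>2 + s p \<le> 1 / 4 + (if p \<in> G then 2 else 0)"
        using p sp sbound[of p] by (auto simp: G_def)
    qed
    also have "\<dots> = (\<Sum>p\<in>J. w p) / 4 + 2 * (\<Sum>p\<in>G. w p)"
    proof -
      have "(\<Sum>p\<in>J. w p * (if p \<in> G then 2 else 0)) = (\<Sum>p\<in>G. 2 * w p)"
        using finJ by (intro sum.mono_neutral_cong_right) (auto simp: G_def)
      then show ?thesis by (simp add: distrib_left sum.distrib sum_distrib_left sum_divide_distrib)
    qed
    finally have "1 \<le> (\<Sum>p\<in>G. w p)" using S1 S2 V0 lnK B by linarith
    \<comment> \<open>Single weights are tiny, so a total weight of 1 forces many primes.\<close>
    also have "\<dots> \<le> (\<Sum>p\<in>G. 2 / sqrt (real N))"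
    proof (rule sum_mono)
      fix p assume "p \<in> G"
      then have p: "real N \<le> real p" "real p > 0" using N by (auto simp: G_def J_def)
      have "w p \<le> 2 * sqrt (real p) / real p"
        unfolding w_def using p by (intro divide_right_mono ln_le_two_sqrt) auto
      also have "\<dots> = 2 / sqrt (real p)" using p by (simp add: real_div_sqrt field_simps)
      also have "\<dots> \<le> 2 / sqrt (real N)" using p N by (intro divide_left_mono) auto
      finally show "w p \<le> 2 / sqrt (real N)" .
    qed
    finally have "sqrt (real N) \<le> 2 * real (card G)" using N by (simp add: field_simps)
    \<comment> \<open>The lower bound on x was chosen for this: N > x - 1 exceeds 4 R^2.\<close>
    moreover have "2 * real R \<le> sqrt (real N)"
      using x N by (intro real_le_rsqrt) (simp add: power_mult_distrib)
    ultimately have "R \<le> card G" by linarith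
    also have "card G \<le> card {p. prime p \<and> x < real p \<and> real p \<le> real K * x \<and> 1 / 8 \<le> Re (u * osc b (real p))}"
    proof (rule card_mono)
      have "{p::nat. prime p \<and> x < real p \<and> real p \<le> real K * x \<and> 1 / 8 \<le> Re (u * osc b (real p))} \<subseteq> {..nat \<lfloor>real K * x\<rfloor>}"
        by (auto simp: le_nat_floor)
      then show "finite {p. prime p \<and> x < real p \<and> real p \<le> real K * x \<and> 1 / 8 \<le> Re (u * osc b (real p))}"
        by (rule finite_subset) auto
      show "G \<subseteq> {p. prime p \<and> x < real p \<and> real p \<le> real K * x \<and> 1 / 8 \<le> Re (u * osc b (real p))}"
      proof
        fix p assume p: "p \<in> G"
        then have "p \<ge> Suc N" "p \<le> K * N" by (auto simp: G_def J_def)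
        then have "real p \<ge> real N + 1" "real p \<le> real K * real N"
          by (auto simp flip: of_nat_mult of_nat_Suc simp del: of_nat_mult)
        moreover have "real K * real N \<le> real K * x" using N by (intro mult_left_mono) auto
        ultimately show "p \<in> {p. prime p \<and> x < real p \<and> real p \<le> real K * x \<and> 1 / 8 \<le> Re (u * osc b (real p))}"
          using p N by (auto simp: G_def J_def s_def)
      qed
    qed
    finally show ?thesis .
  qed
  then show ?thesis using K1 by blast
qed

section \<open>The greedy construction\<close>

lemma of_nat_powr_eq_osc:
  assumes "n > 0"
  shows "(of_nat n :: complex) powr Complex a b = of_real (real n powr a) * osc b (real n)"
proof -
  have "(of_nat n :: complex) powr Complex a b = exp (of_real (a * ln (real n)) + \<i> * of_real (b * ln (real n)))"
    using assms by (simp add: powr_def Complex_eq algebra_simps)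
  then show ?thesis
    using assms by (simp add: exp_add osc_def cis_conv_exp powr_def flip: exp_of_real)
qed

lemma divisor_sigma_mult_prime:
  assumes q: "prime q" "\<not> q dvd n" and n: "n > 0"
  shows "divisor_sigma c (n * q) = divisor_sigma c n * (1 + of_nat q powr c)"
proof -
  let ?D = "{d. d dvd n}"
  have fin: "finite ?D" using n by (intro finite_divisors_nat)
  have eq: "{d. d dvd n * q} = ?D \<union> (*) q ` ?D"
  proof (intro equalityI subsetI)
    fix d assume d: "d \<in> {d. d dvd n * q}"
    show "d \<in> ?D \<union> (*) q ` ?D"
    proof (cases "q dvd d")
      case True
      then obtain e where "d = q * e" by blast
      with d q show ?thesis by (auto simp: mult.commute)
    next
      case False
      then have "coprime d q" using q prime_imp_coprime[of q d] by (simp add: coprime_commute)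
      with d show ?thesis by (simp add: coprime_dvd_mult_left_iff)
    qed
  qed (auto simp: mult.commute)
  have "divisor_sigma c (n * q) = (\<Sum>d\<in>?D. of_nat d powr c) + (\<Sum>d\<in>(*) q ` ?D. of_nat d powr c)"
    unfolding divisor_sigma_def eq using q fin
    by (intro sum.union_disjoint) (auto dest: dvd_mult_left)
  also have "(\<Sum>d\<in>(*) q ` ?D. (of_nat d :: complex) powr c) = (\<Sum>d\<in>?D. of_nat (q * d) powr c)"
    using q by (subst sum.reindex) (auto simp: inj_on_def)
  also have "\<dots> = (\<Sum>d\<in>?D. of_nat q powr c * of_nat d powr c)"
    by (intro sum.cong refl) (simp add: powr_times_real)
  also have "\<dots> = of_nat q powr c * (\<Sum>d\<in>?D. of_nat d powr c)"
    by (simp only: sum_distrib_left)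
  finally show ?thesis
    by (simp add: divisor_sigma_def algebra_simps)
qed

lemma SF_gt_mult_prime:
  assumes "n \<in> SF_gt y" "prime q" "\<not> q dvd n" "real q > y"
  shows "n * q \<in> SF_gt y" "prime_factors (n * q) = insert q (prime_factors n)"
proof -
  have n: "n > 0" "squarefree n" using assms by (auto simp: SF_gt_def)
  have "coprime n q" using assms prime_imp_coprime[of q n] by (simp add: coprime_commute)
  then have sf: "squarefree (n * q)"
    using n assms by (intro squarefree_mult_coprime) (auto intro: squarefree_prime)
  show pf: "prime_factors (n * q) = insert q (prime_factors n)"
    using n assms by (subst prime_factors_product) (auto simp: prime_factorization_prime)
  show "n * q \<in> SF_gt y"
    using assms n sf prime_gt_0_nat[OF assms(2)] unfolding SF_gt_def pf mem_Collect_eq by auto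
qed

lemma one_in_SF_gt: "1 \<in> SF_gt y"
  by (simp add: SF_gt_def)

text \<open>In the expansion of |e - z|^2 an angle with cosine at least 1/8 gains |z||e|/4. The loss
  |z|^2 is at most |z||e|/8, and the remaining |z||e|/8 is the cross term of (|e| -
  |z|/16)^2.\<close>

lemma norm_diff_le_of_acute_angle:
  fixes e z :: complex
  assumes small: "8 * norm z \<le> norm e" and acute: "norm z * norm e / 8 \<le> Re (z * cnj e)"
  shows "norm (e - z) \<le> norm e - norm z / 16"
proof (rule power2_le_imp_le)
  have "(norm (e - z))\<^sup>2 = (norm e)\<^sup>2 - 2 * Re (z * cnj e) + (norm z)\<^sup>2"
    unfolding cmod_power2 by (simp add: power2_eq_square algebra_simps)
  also have "\<dots> \<le> (norm e)\<^sup>2 - norm z * norm e / 4 + (norm z)\<^sup>2" using acute by simp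
  also have "\<dots> \<le> (norm e)\<^sup>2 - norm z * norm e / 4 + norm z * (norm e / 8)"
    using mult_left_mono[OF small, of "norm z / 8"] by (simp add: power2_eq_square algebra_simps)
  also have "\<dots> \<le> (norm e - norm z / 16)\<^sup>2"
    by (simp add: power2_eq_square algebra_simps)
  finally show "(norm (e - z))\<^sup>2 \<le> (norm e - norm z / 16)\<^sup>2" .
  show "0 \<le> norm e - norm z / 16" using small norm_ge_zero[of z] by linarith
qed

text \<open>One stage of the greedy procedure, using at most R primes of (x, K x]. The choice of M
  makes the target error 12 x^a, so until it is reached a correction of size at most (3/2) x^a is at
  most an eighth of the error.\<close>

lemma greedy_block:
  fixes a b K x y :: real and \<xi> :: complex and R :: nat
  assumes a: "a < 0" and K: "K > 1" and x: "0 < y" "y \<le> x"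
    and M: "M = 12 * K powr (-a)" and R: "32 * M * K powr (-a) \<le> real R"
    and primes: "\<And>u. norm u = 1 \<Longrightarrow>
      R \<le> card {p. prime p \<and> x < real p \<and> real p \<le> K * x \<and> 1 / 8 \<le> Re (u * osc b (real p))}"
    and near: "norm (\<xi> - 1) + M * x powr a \<le> 1 / 2"
    and n: "n \<in> SF_gt y" "\<forall>p\<in>prime_factors n. real p \<le> x"
      "norm (\<xi> - divisor_sigma (Complex a b) n) \<le> M * x powr a"
  shows "\<exists>m\<in>SF_gt y. (\<forall>p\<in>prime_factors m. real p \<le> K * x) \<and>
           norm (\<xi> - divisor_sigma (Complex a b) m) \<le> M * (K * x) powr a"
proof -
  define c where "c = Complex a b"
  have xK: "x \<le> K * x" "x > 0" using K x by auto
  have xKa: "(K * x) powr a = K powr a * x powr a" using K xK by (simp add: powr_mult)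
  have MK: "M * (K * x) powr a = 12 * x powr a"
    using K by (simp add: M xKa powr_minus)
  \<comment> \<open>After k steps at most k primes of (x, K x] are used up, so for k < R a suitable
    fresh one remains. Either the target is reached already, or each step has lowered the bound on
    the error by (K x)^a / 32.\<close>
  have "\<exists>m\<in>SF_gt y. (\<forall>p\<in>prime_factors m. real p \<le> K * x) \<and>
      card {p\<in>prime_factors m. x < real p} \<le> k \<and>
      (norm (\<xi> - divisor_sigma c m) \<le> M * (K * x) powr a \<or>
       norm (\<xi> - divisor_sigma c m) \<le> M * x powr a - real k * ((K * x) powr a / 32))"
    if "k \<le> R" for k
    using that
  proof (induction k)
    case 0
    have "{p\<in>prime_factors n. x < real p} = {}" using n(2) by auto
    moreover have "\<forall>p\<in>prime_factors n. real p \<le> K * x" using n(2) xK(1) order_trans by blast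
    ultimately show ?case using n unfolding c_def by (intro bexI[of _ n]) auto
  next
    case (Suc k)
    then obtain m where m: "m \<in> SF_gt y" "\<forall>p\<in>prime_factors m. real p \<le> K * x"
      "card {p\<in>prime_factors m. x < real p} \<le> k"
      "norm (\<xi> - divisor_sigma c m) \<le> M * (K * x) powr a \<or>
       norm (\<xi> - divisor_sigma c m) \<le> M * x powr a - real k * ((K * x) powr a / 32)"
      by auto
    show ?case
    proof (cases "norm (\<xi> - divisor_sigma c m) \<le> M * (K * x) powr a")
      case True
      with m show ?thesis by (intro bexI[of _ m]) auto
    next
      case False
      define s where "s = divisor_sigma c m"
      define e where "e = \<xi> - s"
      have e: "norm e > 12 * x powr a" "norm e \<le> M * x powr a - real k * ((K * x) powr a / 32)"
        using False m(4) MK by (auto simp: e_def s_def)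
      have "real k * ((K * x) powr a / 32) \<ge> 0" by simp
      with e(2) have eM: "norm e \<le> M * x powr a" by linarith
      have e0: "norm e > 0" using e(1) by (smt (verit) powr_ge_zero)
      \<comment> \<open>The assumption \<open>near\<close> keeps sigma within 1/2 of 1, so every
        correction s q^c is comparable in size to q^a.\<close>
      have s1: "norm (s - 1) \<le> 1 / 2"
      proof -
        have "s - 1 = (\<xi> - 1) - e" by (simp add: e_def)
        then have "norm (s - 1) \<le> norm (\<xi> - 1) + norm e" by (simp only: norm_triangle_ineq4)
        with eM near show ?thesis by linarith
      qed
      have s: "1 / 2 \<le> norm s" "norm s \<le> 3 / 2"
        using s1 norm_triangle_ineq2[of 1 s] norm_triangle_ineq2[of s 1] by (auto simp: norm_minus_commute)
      have "norm s > 0" using s(1) by linarith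
      then have nonzero: "s \<noteq> 0" "e \<noteq> 0" using e0 by auto
      \<comment> \<open>With this \<open>u\<close>, the real part of u q^{ib} is the cosine of the
        angle between s q^c and the error e.\<close>
      define u where "u = s * cnj e / of_real (norm s * norm e)"
      have u: "norm u = 1" using nonzero by (simp add: u_def norm_divide norm_mult)
      define P where "P = {p. prime p \<and> x < real p \<and> real p \<le> K * x \<and> 1 / 8 \<le> Re (u * osc b (real p))}"
      have "\<not> P \<subseteq> {p\<in>prime_factors m. x < real p}"
      proof
        assume "P \<subseteq> {p\<in>prime_factors m. x < real p}"
        then have "card P \<le> card {p\<in>prime_factors m. x < real p}" by (intro card_mono) auto
        with m(3) primes[OF u] Suc.prems show False unfolding P_def by linarith
      qed
      then obtain q where q: "q \<in> P" "q \<notin> prime_factors m" unfolding P_def by auto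
      have q1: "prime q" "x < real q" "real q \<le> K * x" "1 / 8 \<le> Re (u * osc b (real q))"
        using q(1) by (auto simp: P_def)
      have m0: "m > 0" using m(1) by (simp add: SF_gt_def)
      have qm: "\<not> q dvd m" using q(2) q1(1) m0 by (simp add: prime_factors_dvd)
      have q0: "q > 0" using q1(1) prime_gt_0_nat by blast
      define z where "z = s * (of_nat q powr c)"
      have qc: "of_nat q powr c = of_real (real q powr a) * osc b (real q)"
        unfolding c_def by (rule of_nat_powr_eq_osc[OF q0])
      have nz: "norm z = norm s * real q powr a"
        by (simp add: z_def qc norm_mult)
      have qa: "real q powr a \<le> x powr a" "(K * x) powr a \<le> real q powr a"
        using q1 a xK by (auto intro!: powr_mono2')
      have z_le: "8 * norm z \<le> norm e"
      proof -
        have "norm z \<le> 3 / 2 * x powr a" unfolding nz using s qa by (intro mult_mono) auto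
        with e show ?thesis by linarith
      qed
      have z_ge: "(K * x) powr a / 2 \<le> norm z"
        using mult_mono[OF s(1) qa(2)] unfolding nz by simp
      have "norm z * norm e / 8 \<le> norm z * norm e * Re (u * osc b (real q))"
        using mult_left_mono[OF q1(4), of "norm z * norm e"] by simp
      also have "\<dots> = Re (of_real (norm z * norm e) * (u * osc b (real q)))"
        by (simp only: Re_complex_of_real Im_complex_of_real times_complex.sel)
      also have "of_real (norm z * norm e) * (u * osc b (real q)) = z * cnj e"
        using nonzero unfolding u_def nz by (simp add: z_def qc divide_simps)
      finally have "norm (e - z) \<le> norm e - norm z / 16"
        by (intro norm_diff_le_of_acute_angle z_le)
      \<comment> \<open>The gain |z|/16 is at least (K x)^a / 32 because |s| \<ge> 1/2.\<close>
      also have "\<dots> \<le> M * x powr a - real (Suc k) * ((K * x) powr a / 32)"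
        using e(2) z_ge by (simp add: algebra_simps add_divide_distrib)
      finally have ez: "norm (e - z) \<le> M * x powr a - real (Suc k) * ((K * x) powr a / 32)" .
      have "divisor_sigma c (m * q) = s + z"
        unfolding divisor_sigma_mult_prime[OF q1(1) qm m0] s_def z_def by (simp add: distrib_left)
      then have "\<xi> - divisor_sigma c (m * q) = e - z" by (simp add: e_def)
      moreover have "real q > y" using q1 x by simp
      note sf = SF_gt_mult_prime[OF m(1) q1(1) qm this]
      have "{p\<in>prime_factors (m * q). x < real p} = insert q {p\<in>prime_factors m. x < real p}"
        unfolding sf(2) using q1 by auto
      then have "card {p\<in>prime_factors (m * q). x < real p} \<le> Suc k"
        using m(3) card_insert_le_m1[of "Suc k" "{p\<in>prime_factors m. x < real p}" q] by simp
      moreover have "\<forall>p\<in>prime_factors (m * q). real p \<le> K * x"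
        unfolding sf(2) using m(2) q1(3) by auto
      ultimately show ?thesis
        using ez sf(1) by (intro bexI[of _ "m * q"]) auto
    qed
  qed
  from this[of R] obtain m where m: "m \<in> SF_gt y" "\<forall>p\<in>prime_factors m. real p \<le> K * x"
    "norm (\<xi> - divisor_sigma c m) \<le> M * (K * x) powr a \<or>
     norm (\<xi> - divisor_sigma c m) \<le> M * x powr a - real R * ((K * x) powr a / 32)"
    by auto
  \<comment> \<open>R is so large that R full gains would exhaust the initial error; thus both
    alternatives give the target bound.\<close>
  have "M * x powr a - real R * ((K * x) powr a / 32) \<le> 0"
  proof -
    have "32 * M * K powr (-a) * (K * x) powr a \<le> real R * (K * x) powr a"
      by (intro mult_right_mono R) auto
    also have "32 * M * K powr (-a) * (K * x) powr a = 32 * M * x powr a"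
      using K by (simp add: xKa powr_minus)
    finally show ?thesis by simp
  qed
  moreover have "0 \<le> M * (K * x) powr a" unfolding MK by simp
  ultimately have "norm (\<xi> - divisor_sigma c m) \<le> M * (K * x) powr a" using m(3) by linarith
  with m show ?thesis unfolding c_def by blast
qed

theorem theorem4:
  fixes c :: complex and a b :: real
  assumes "c = Complex a b" and "a < -1" and "b \<noteq> 0"
  shows "\<exists>y0::real. \<forall>y\<ge>y0.
           {\<xi>::complex. cmod (\<xi> - 1) < 2 * y powr a} \<subseteq> closure (divisor_sigma c ` SF_gt y)"
proof -
  obtain K where K: "K > 1" and dirs: "\<And>R::nat. \<exists>X. \<forall>x\<ge>X. \<forall>u. norm u = 1 \<longrightarrow>
      R \<le> card {p. prime p \<and> x < real p \<and> real p \<le> K * x \<and> 1 / 8 \<le> Re (u * osc b (real p))}"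
    using primes_in_every_direction[OF assms(3)] by auto
  define M where "M = 12 * K powr (-a)"
  have "K powr 0 \<le> K powr (-a)" using K assms(2) by (intro powr_mono) auto
  then have M: "M \<ge> 12" using K by (simp add: M_def)
  define R where "R = nat \<lceil>32 * M * K powr (-a)\<rceil>"
  have R: "32 * M * K powr (-a) \<le> real R" unfolding R_def by linarith
  obtain X where X: "\<And>x u. x \<ge> X \<Longrightarrow> norm u = 1 \<Longrightarrow>
      R \<le> card {p. prime p \<and> x < real p \<and> real p \<le> K * x \<and> 1 / 8 \<le> Re (u * osc b (real p))}"
    using dirs[of R] by blast
  have powr_le: "x powr a \<le> 1 / x" if "x \<ge> 1" for x :: real
    using powr_mono[of a "-1" x] assms(2) that by (simp add: powr_minus divide_inverse)
  \<comment> \<open>The bound y \<ge> X makes primes available at every scale K^j y. The bound y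
    \<ge> 2 (M + 2) ensures \<open>near\<close> at every stage, the 2 covering |\<xi> - 1| and the M
    the current error.\<close>
  have "\<xi> \<in> closure (divisor_sigma c ` SF_gt y)"
    if y: "y \<ge> max X (2 * (M + 2))" and \<xi>: "norm (\<xi> - 1) < 2 * y powr a" for y \<xi>
  proof -
    have y1: "y \<ge> 1" "y \<ge> X" "y \<ge> 2 * (M + 2)" using y M by auto
    have small: "(M + 2) * y powr a \<le> 1 / 2"
    proof -
      have "(M + 2) * y powr a \<le> (M + 2) * (1 / y)"
        using M y1 by (intro mult_left_mono powr_le) auto
      also have "\<dots> \<le> 1 / 2" using y1 by (simp add: field_simps)
      finally show ?thesis .
    qed
    have approx: "\<exists>n\<in>SF_gt y. (\<forall>p\<in>prime_factors n. real p \<le> K ^ j * y) \<and>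
        norm (\<xi> - divisor_sigma c n) \<le> M * (K ^ j * y) powr a" for j
    proof (induction j)
      case 0
      have "divisor_sigma c 1 = 1" by (simp add: divisor_sigma_def)
      \<comment> \<open>The start n = 1 has error below 2 y^a, which M \<ge> 12 covers.\<close>
      moreover have "2 * y powr a \<le> M * y powr a" using M by (intro mult_right_mono) auto
      ultimately show ?case using \<xi> one_in_SF_gt by (intro bexI[of _ 1]) auto
    next
      case (Suc j)
      then obtain n where n: "n \<in> SF_gt y" "\<forall>p\<in>prime_factors n. real p \<le> K ^ j * y"
        "norm (\<xi> - divisor_sigma c n) \<le> M * (K ^ j * y) powr a" by blast
      have Kj: "K ^ j \<ge> 1" using K by simp
      then have xy: "y \<le> K ^ j * y" using y1 mult_right_mono[of 1 "K ^ j" y] by simp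
      have "(K ^ j * y) powr a \<le> y powr a" using xy y1 assms(2) by (intro powr_mono2') auto
      then have "M * (K ^ j * y) powr a \<le> M * y powr a" using M by (intro mult_left_mono) auto
      then have near: "norm (\<xi> - 1) + M * (K ^ j * y) powr a \<le> 1 / 2"
        using small \<xi> by (simp add: algebra_simps)
      have "\<exists>m\<in>SF_gt y. (\<forall>p\<in>prime_factors m. real p \<le> K * (K ^ j * y)) \<and>
          norm (\<xi> - divisor_sigma (Complex a b) m) \<le> M * (K * (K ^ j * y)) powr a"
      proof (rule greedy_block[OF _ K _ xy M_def R _ near n(1,2)])
        show "norm (\<xi> - divisor_sigma (Complex a b) n) \<le> M * (K ^ j * y) powr a"
          using n(3) assms(1) by simp
        show "R \<le> card {p. prime p \<and> K ^ j * y < real p \<and> real p \<le> K * (K ^ j * y) \<and>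
            1 / 8 \<le> Re (u * osc b (real p))}" if "norm u = 1" for u
          using X[OF _ that] xy y1 by (meson order_trans)
      qed (use y1 assms(2) in auto)
      then show ?case using assms(1) by (simp add: mult.assoc)
    qed
    show ?thesis
    proof (rule closure_approachable[THEN iffD2], intro allI impI)
      fix e :: real assume e: "e > 0"
      obtain j where j: "M / e < K ^ j" using real_arch_pow[OF K] by blast
      obtain n where n: "n \<in> SF_gt y" "norm (\<xi> - divisor_sigma c n) \<le> M * (K ^ j * y) powr a"
        using approx[of j] by blast
      have Kj: "K ^ j \<ge> 1" using K by simp
      then have Ky: "K ^ j \<le> K ^ j * y" using y1 mult_left_mono[of 1 y "K ^ j"] by simp
      \<comment> \<open>The error bound at scale K^j y decays at least like M / K^j, and j was
        chosen to bring this below e.\<close>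
      have "(K ^ j * y) powr a \<le> 1 / (K ^ j * y)" using Ky Kj by (intro powr_le) linarith
      also have "\<dots> \<le> 1 / K ^ j" using Ky Kj by (intro divide_left_mono) auto
      finally have "M * (K ^ j * y) powr a \<le> M * (1 / K ^ j)" using M by (intro mult_left_mono) auto
      also have "\<dots> < e" using j e Kj by (simp add: field_simps)
      finally show "\<exists>z\<in>divisor_sigma c ` SF_gt y. dist z \<xi> < e"
        using n by (auto simp: dist_norm norm_minus_commute intro!: bexI[of _ n])
    qed
  qed
  then show ?thesis by (intro exI[of _ "max X (2 * (M + 2))"]) blast
qed

end
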